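(* Let $\epsilon<\frac{M}{1-\gamma}$ and $\delta\in(0,1)$. With probability $1-\delta$, the invocation \[ \texttt{RandomizedVI}\left(\vec 0,\ \left\lceil\frac{1}{1-\gamma}\log\left(\frac{2M}{(1-\gamma)^2\epsilon}\right)\right\rceil,\ \frac{(1-\gamma)\epsilon}{4\gamma},\ \delta\right) \] produces $v_L\in\mathbb{R}^S$ with $\|v_L-v^*\|_\infty\le\epsilon$, and it can be implemented to run in time \[ \tilde O\left(\frac{|S||A|M^2}{(1-\gamma)^5\epsilon^2}\log\left(\frac1\epsilon\right)\right). \]
   Context: DMDP $(S,A,P,r,\gamma)$: finite states $S$, finite actions $A$, probability vectors $p_a(i)\in\mathbb{R}^S$ for $i\in S,a\in A$, rewards $r_a(i)\in[-M,M]$ ($M>0$ known), discount $\gamma\in(0,1)$. For any $i,a$ an independent sample $j\in S$ with $\Pr[j=k]=p_a(i,k)$ can be drawn in expected $O(1)$ time. Value operator $T(u)_i=\max_{a\in A}[r_a(i)+\gamma p_a(i)^\top u]$, with unique fixed point $v^*$; for a policy $\pi\in A^S$, $T_\pi(u)_i=r_{\pi_i}(i)+\gamma p_{\pi_i}(i)^\top u$. Subroutines. $\texttt{ApxTrans}(u,M',i,a,\epsilon,\delta)$ (with $\|u\|_\infty\le M'$): set $m=\lceil\frac{2M'^2}{\epsilon^2}\ln\frac2\delta\rceil$, draw $i_1,\dots,i_m$ independently from $p_a(i)$, return $\frac1m\sum_k u_{i_k}$. $\texttt{ApxVal}(u,v_0,x,\epsilon,\delta)$ (with $x\in\mathbb{R}^{S\times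 A}$, $|x_a(i)-p_a(i)^\top v_0|\le\epsilon$ for all $i,a$): let $M'=\|u-v_0\|_\infty$; for every $i\in S,a\in A$ set $\tilde S_a(i)=x_a(i)+\texttt{ApxTrans}(u-v_0,M',i,a,\epsilon,\delta/(|S||A|))$ and $\tilde Q_a(i)=r_a(i)+\gamma\tilde S_a(i)$; set $\tilde v_i=\max_a\tilde Q_a(i)$ and $\pi_i\in\arg\max_a\tilde Q_a(i)$; return $(\tilde v,\pi)$. $\texttt{RandomizedVI}(v_0,L,\epsilon,\delta)$: compute $x_a(i)=p_a(i)^\top v_0$ exactly for all $i,a$; for $l=1,\dots,L$ set $(v_l,\pi_l)=\texttt{ApxVal}(v_{l-1},v_0,x,\epsilon,\delta/L)$; return $(v_L,\pi_L)$. $\tilde O$ hides polylogarithmic factors.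
   Formalization: The factor log(1/ε) in the running time is read as max(1, log(1/ε)), since ε ≥ 1 is allowed and the literal bound would then be zero or negative; running time means expected time, as samples cost expected O(1). *)

theory Defs
  imports "HOL-Probability.Probability"
begin

section \<open>Discounted Markov decision processes\<close>

text \<open>
  States and actions are numbered: \<open>S = {..<nS}\<close> and \<open>A = {..<nA}\<close>.  The probability vector
  \<open>p\<^sub>a(i)\<close> is the pmf \<open>trans_pmf D i a\<close>, supported in \<open>S\<close>, and \<open>r\<^sub>a(i)\<close> is \<open>reward D i a\<close>.
  Vectors in \<open>\<real>\<^sup>S\<close> are functions \<open>nat \<Rightarrow> real\<close>; all vectors produced below vanish outside \<open>S\<close>.
\<close>

record dmdp =
  nS :: nat
  nA :: nat
  trans_pmf :: "nat \<Rightarrow> nat \<Rightarrow> nat pmf"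
  reward :: "nat \<Rightarrow> nat \<Rightarrow> real"
  discount :: real

definition is_dmdp :: "dmdp \<Rightarrow> real \<Rightarrow> bool" where
  "is_dmdp D M \<longleftrightarrow>
     0 < nS D \<and> 0 < nA D \<and> 0 < M \<and> 0 < discount D \<and> discount D < 1 \<and>
     (\<forall>i<nS D. \<forall>a<nA D. set_pmf (trans_pmf D i a) \<subseteq> {..<nS D} \<and> reward D i a \<in> {-M..M})"

definition expected_val :: "dmdp \<Rightarrow> (nat \<Rightarrow> real) \<Rightarrow> nat \<Rightarrow> nat \<Rightarrow> real" where
  "expected_val D u i a = (\<Sum>j<nS D. pmf (trans_pmf D i a) j * u j)"

definition value_op :: "dmdp \<Rightarrow> (nat \<Rightarrow> real) \<Rightarrow> nat \<Rightarrow> real" where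
  "value_op D u = (\<lambda>i. if i < nS D
     then Max ((\<lambda>a. reward D i a + discount D * expected_val D u i a) ` {..<nA D}) else 0)"

definition opt_val :: "dmdp \<Rightarrow> nat \<Rightarrow> real" where
  "opt_val D = (THE v. value_op D v = v)"

definition sup_norm :: "dmdp \<Rightarrow> (nat \<Rightarrow> real) \<Rightarrow> real" where
  "sup_norm D u = Max ((\<lambda>i. \<bar>u i\<bar>) ` {..<nS D})"


section \<open>Randomized value iteration\<close>

text \<open>
  For \<open>m = 0\<close> (which happens when \<open>M' = 0\<close>, so in the first round of \<open>RandomizedVI\<close>) the empty
  average is \<open>0\<close>.
\<close>

definition ApxTrans ::
  "dmdp \<Rightarrow> (nat \<Rightarrow> real) \<Rightarrow> real \<Rightarrow> nat \<Rightarrow> nat \<Rightarrow> real \<Rightarrow> real \<Rightarrow> real pmf" where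
  "ApxTrans D u M' i a \<epsilon> \<delta> =
     (let m = nat \<lceil>2 * M'\<^sup>2 / \<epsilon>\<^sup>2 * ln (2 / \<delta>)\<rceil>
      in map_pmf (\<lambda>js. (\<Sum>j\<leftarrow>js. u j) / real m) (replicate_pmf m (trans_pmf D i a)))"

text \<open>
  The choice of a maximizing action among several ones is left open by the algorithm; it is a
  parameter here.
\<close>

definition tie_breaking :: "(nat set \<Rightarrow> nat) \<Rightarrow> bool" where
  "tie_breaking pick \<longleftrightarrow> (\<forall>X. finite X \<longrightarrow> X \<noteq> {} \<longrightarrow> pick X \<in> X)"

definition ApxVal ::
  "(nat set \<Rightarrow> nat) \<Rightarrow> dmdp \<Rightarrow> (nat \<Rightarrow> real) \<Rightarrow> (nat \<Rightarrow> real) \<Rightarrow> (nat \<Rightarrow> nat \<Rightarrow> real) \<Rightarrow>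
   real \<Rightarrow> real \<Rightarrow> ((nat \<Rightarrow> real) \<times> (nat \<Rightarrow> nat)) pmf" where
  "ApxVal pick D u v0 x \<epsilon> \<delta> =
     (let w = (\<lambda>j. u j - v0 j); M' = sup_norm D w
      in do {
        Y \<leftarrow> Pi_pmf ({..<nS D} \<times> {..<nA D}) 0
               (\<lambda>(i, a). ApxTrans D w M' i a \<epsilon> (\<delta> / real (nS D * nA D)));
        let Q = (\<lambda>i a. reward D i a + discount D * (x i a + Y (i, a)));
        return_pmf
          (\<lambda>i. if i < nS D then Max (Q i ` {..<nA D}) else 0,
           \<lambda>i. if i < nS D then pick {a. is_arg_max (Q i) (\<lambda>a. a < nA D) a} else 0)
      })"

primrec RandomizedVI_iter ::
  "(nat set \<Rightarrow> nat) \<Rightarrow> dmdp \<Rightarrow> (nat \<Rightarrow> real) \<Rightarrow> (nat \<Rightarrow> nat \<Rightarrow> real) \<Rightarrow> real \<Rightarrow> real \<Rightarrow> nat \<Rightarrow>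
   ((nat \<Rightarrow> real) \<times> (nat \<Rightarrow> nat)) pmf" where
  "RandomizedVI_iter pick D v0 x \<epsilon> \<delta>' 0 = return_pmf (v0, \<lambda>_. 0)"
| "RandomizedVI_iter pick D v0 x \<epsilon> \<delta>' (Suc l) =
     do {
       (v, _) \<leftarrow> RandomizedVI_iter pick D v0 x \<epsilon> \<delta>' l;
       ApxVal pick D v v0 x \<epsilon> \<delta>'
     }"

definition RandomizedVI ::
  "(nat set \<Rightarrow> nat) \<Rightarrow> dmdp \<Rightarrow> (nat \<Rightarrow> real) \<Rightarrow> nat \<Rightarrow> real \<Rightarrow> real \<Rightarrow>
   ((nat \<Rightarrow> real) \<times> (nat \<Rightarrow> nat)) pmf" where
  "RandomizedVI pick D v0 L \<epsilon> \<delta> =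
     RandomizedVI_iter pick D v0 (expected_val D v0) \<epsilon> (\<delta> / real L) L"


section \<open>A real random access machine with a sampling oracle\<close>

text \<open>
  Running times are those of programs in a fixed imperative language over named arrays of reals,
  where every arithmetic operation, memory access, comparison and loop step takes unit time.
  Scalars live in cell \<open>0\<close> of an array.  The only constants are integers, and the only loops are
  counting loops whose number of rounds is fixed on entry, so every program terminates.
\<close>

type_synonym store = "string \<Rightarrow> nat \<Rightarrow> real"

datatype aexp =
    Const int
  | Read string aexp
  | Add aexp aexp
  | Sub aexp aexp
  | Mul aexp aexp
  | Div aexp aexp
  | Ln aexp
  | Ceil aexp

primrec aval :: "aexp \<Rightarrow> store \<Rightarrow> real" where
  "aval (Const z) s = of_int z"
| "aval (Read x e) s = s x (nat \<lfloor>aval e s\<rfloor>)"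
| "aval (Add e1 e2) s = aval e1 s + aval e2 s"
| "aval (Sub e1 e2) s = aval e1 s - aval e2 s"
| "aval (Mul e1 e2) s = aval e1 s * aval e2 s"
| "aval (Div e1 e2) s = aval e1 s / aval e2 s"
| "aval (Ln e) s = ln (aval e s)"
| "aval (Ceil e) s = of_int \<lceil>aval e s\<rceil>"

primrec atime :: "aexp \<Rightarrow> nat" where
  "atime (Const z) = 1"
| "atime (Read x e) = 1 + atime e"
| "atime (Add e1 e2) = 1 + atime e1 + atime e2"
| "atime (Sub e1 e2) = 1 + atime e1 + atime e2"
| "atime (Mul e1 e2) = 1 + atime e1 + atime e2"
| "atime (Div e1 e2) = 1 + atime e1 + atime e2"
| "atime (Ln e) = 1 + atime e"
| "atime (Ceil e) = 1 + atime e"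

definition nval :: "aexp \<Rightarrow> store \<Rightarrow> nat" where
  "nval e s = nat \<lfloor>aval e s\<rfloor>"

definition store_at :: "string \<Rightarrow> nat \<Rightarrow> real \<Rightarrow> store \<Rightarrow> store" where
  "store_at x k y s = s(x := (s x)(k := y))"

text \<open>
  \<open>Assign x e e'\<close> stores the value of \<open>e'\<close> in cell \<open>e\<close> of \<open>x\<close>; \<open>Sample x e e'\<close> stores in the scalar
  \<open>x\<close> the state drawn by the oracle for state \<open>e\<close> and action \<open>e'\<close>; \<open>IfLe e e'\<close> tests \<open>e \<le> e'\<close>;
  \<open>For x e c\<close> runs \<open>c\<close> with the scalar \<open>x\<close> set to \<open>0, 1, \<dots>, \<lfloor>e\<rfloor> - 1\<close>.
\<close>

datatype cmd =
    Skip
  | Assign string aexp aexp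
  | Sample string aexp aexp
  | Seq cmd cmd
  | IfLe aexp aexp cmd cmd
  | For string aexp cmd

primrec iterate :: "(nat \<Rightarrow> store \<Rightarrow> (store \<times> nat) pmf) \<Rightarrow> nat \<Rightarrow> store \<Rightarrow> (store \<times> nat) pmf" where
  "iterate f 0 s = return_pmf (s, 0)"
| "iterate f (Suc n) s =
     do {
       (s1, t1) \<leftarrow> iterate f n s;
       (s2, t2) \<leftarrow> f n s1;
       return_pmf (s2, t1 + t2)
     }"

text \<open>
  A call of the oracle \<open>smp i a\<close> yields a state together with the time spent on drawing it; the two
  may be correlated.  \<open>exec\<close> yields the joint distribution of the final store and the running time.
\<close>

primrec exec :: "(nat \<Rightarrow> nat \<Rightarrow> (nat \<times> nat) pmf) \<Rightarrow> cmd \<Rightarrow> store \<Rightarrow> (store \<times> nat) pmf" where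
  "exec smp Skip s = return_pmf (s, 1)"
| "exec smp (Assign x e e') s =
     return_pmf (store_at x (nval e s) (aval e' s) s, 1 + atime e + atime e')"
| "exec smp (Sample x e e') s =
     do {
       (j, t) \<leftarrow> smp (nval e s) (nval e' s);
       return_pmf (store_at x 0 (real j) s, 1 + atime e + atime e' + t)
     }"
| "exec smp (Seq c1 c2) s =
     do {
       (s1, t1) \<leftarrow> exec smp c1 s;
       (s2, t2) \<leftarrow> exec smp c2 s1;
       return_pmf (s2, t1 + t2)
     }"
| "exec smp (IfLe e e' c1 c2) s =
     do {
       (s1, t1) \<leftarrow> (if aval e s \<le> aval e' s then exec smp c1 s else exec smp c2 s);
       return_pmf (s1, 1 + atime e + atime e' + t1)
     }"
| "exec smp (For x e c) s =
     do {
       (s1, t1) \<leftarrow> iterate (\<lambda>k s'. do {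
                      (s2, t2) \<leftarrow> exec smp c (store_at x 0 (real k) s');
                      return_pmf (s2, 1 + t2)
                    }) (nval e s) s;
       return_pmf (s1, 1 + atime e + t1)
     }"

text \<open>A sampler draws from \<open>p\<^sub>a(i)\<close> in expected time at most \<open>c\<close>.\<close>

definition is_sampler :: "dmdp \<Rightarrow> real \<Rightarrow> (nat \<Rightarrow> nat \<Rightarrow> (nat \<times> nat) pmf) \<Rightarrow> bool" where
  "is_sampler D c smp \<longleftrightarrow>
     (\<forall>i<nS D. \<forall>a<nA D.
        map_pmf fst (smp i a) = trans_pmf D i a \<and>
        (\<integral>\<^sup>+ jt. of_nat (snd jt) \<partial>measure_pmf (smp i a)) \<le> ennreal c)"

text \<open>The whole input is given to a program, with matrices laid out row by row.\<close>

definition input_store :: "dmdp \<Rightarrow> real \<Rightarrow> real \<Rightarrow> real \<Rightarrow> store" where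
  "input_store D M \<epsilon> \<delta> =
     (\<lambda>_ _. 0)
      (''nS'' := (\<lambda>_. 0)(0 := real (nS D)),
       ''nA'' := (\<lambda>_. 0)(0 := real (nA D)),
       ''gamma'' := (\<lambda>_. 0)(0 := discount D),
       ''M'' := (\<lambda>_. 0)(0 := M),
       ''eps'' := (\<lambda>_. 0)(0 := \<epsilon>),
       ''delta'' := (\<lambda>_. 0)(0 := \<delta>),
       ''r'' := (\<lambda>k. if k < nS D * nA D then reward D (k div nA D) (k mod nA D) else 0),
       ''p'' := (\<lambda>k. if k < nS D * nA D * nS D
                  then pmf (trans_pmf D (k div nS D div nA D) (k div nS D mod nA D)) (k mod nS D)
                  else 0))"

definition output_of :: "dmdp \<Rightarrow> store \<Rightarrow> (nat \<Rightarrow> real) \<times> (nat \<Rightarrow> nat)" where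
  "output_of D s =
     (\<lambda>i. if i < nS D then s ''v'' i else 0, \<lambda>i. if i < nS D then nat \<lfloor>s ''pi'' i\<rfloor> else 0)"

definition expected_time :: "(store \<times> nat) pmf \<Rightarrow> ennreal" where
  "expected_time R = (\<integral>\<^sup>+ st. of_nat (snd st) \<partial>measure_pmf R)"

text \<open>
  The base of the polylogarithmic factors hidden by the soft-O notation: the logarithm of all
  parameters of the problem.
\<close>

definition param_log :: "dmdp \<Rightarrow> real \<Rightarrow> real \<Rightarrow> real \<Rightarrow> real" where
  "param_log D M \<epsilon> \<delta> =
     ln (2 + real (nS D) + real (nA D) + M + 1 / (1 - discount D) + 1 / \<epsilon> + 1 / \<delta>)"

end

(*
  Accuracy.  By Hoeffding's inequality and a union bound over states and actions, a call of ApxVal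
  is within gamma * eps' of the value operator with probability at least 1 - delta / L.  The value
  operator is a gamma-contraction, so the error of v_L is at most
  gamma^L * M / (1 - gamma) + gamma * eps' / (1 - gamma), which is at most eps / 2 + eps / 4.

  Running time.  All iterates are bounded by M / (1 - gamma), hence a call of ApxTrans draws
  O(M^2 / ((1 - gamma)^4 * eps^2)) samples up to a logarithm; there are nS * nA calls in each of the
  O(1 / (1 - gamma)) rounds, again up to a logarithm.  The program is verified compositionally: a
  coupling relates its final store to the outcome of the abstract algorithm, together with a bound
  on its expected running time.
*)

theory Submission
  imports Defs
begin

section \<open>Accuracy of randomized value iteration\<close>

text \<open>Two kinds of uniformity shape the proof. Accuracy is adaptive, since each round samples
  against the random iterate of the round before. The one-round bound is therefore proved for an
  arbitrary fixed vector, and rounds are chained by conditioning. Time is an expectation over all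
  runs, including those where accuracy fails, so the bound on the iterates has to hold on the whole
  support and not just with high probability. It does, because a sample mean never exceeds the
  vector in absolute value. The program must reproduce the abstract distribution exactly, although
  the algorithm draws a whole table of estimates as one product and the program draws single samples
  in nested loops. Hence every abstract distribution is recast as a recursion that follows a loop.
  Of the four powers of 1/(1-\<gamma>) in the sample count, two stem from the range of the iterates
  and two from the accuracy per round, which is of order (1-\<gamma>)\<epsilon> because errors of
  the rounds accumulate by a factor 1/(1-\<gamma>).\<close>

text \<open>Hoeffding's inequality speaks of indexed independent variables, the algorithm of a list
  of samples. Only the sum matters, so it is harmless that the list grows at its head and the
  product at its last index; \<open>d\<close> is the default outside \<open>{..<n}\<close>.\<close>

lemma map_sum_list_replicate_pmf:
  fixes u :: "'a \<Rightarrow> real"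
  shows "map_pmf (\<lambda>js. \<Sum>j\<leftarrow>js. u j) (replicate_pmf n p) =
         map_pmf (\<lambda>f. \<Sum>i<n. u (f i)) (Pi_pmf {..<n} d (\<lambda>_. p))"
proof (induction n)
  case (Suc n)
  have "map_pmf (\<lambda>js. \<Sum>j\<leftarrow>js. u j) (replicate_pmf (Suc n) p) =
        p \<bind> (\<lambda>x. map_pmf (\<lambda>s. u x + s) (map_pmf (\<lambda>js. \<Sum>j\<leftarrow>js. u j) (replicate_pmf n p)))"
    by (simp add: map_bind_pmf map_pmf_comp map_pmf_def[symmetric])
  also have "\<dots> = p \<bind> (\<lambda>x. map_pmf (\<lambda>f. u x + (\<Sum>i<n. u (f i))) (Pi_pmf {..<n} d (\<lambda>_. p)))"
    by (simp add: Suc.IH map_pmf_comp)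
  also have "\<dots> = map_pmf (\<lambda>f. \<Sum>i<Suc n. u (f i)) (Pi_pmf {..<Suc n} d (\<lambda>_. p))"
    by (simp add: lessThan_Suc Pi_pmf_insert' map_bind_pmf map_pmf_def[symmetric] map_pmf_comp o_def)
  finally show ?case .
qed (simp add: map_pmf_def bind_return_pmf)

lemma expected_val_eq_expectation:
  assumes "set_pmf (trans_pmf D i a) \<subseteq> {..<nS D}"
  shows "expected_val D u i a = measure_pmf.expectation (trans_pmf D i a) u"
  unfolding expected_val_def
  by (subst integral_measure_pmf_real[where A = "{..<nS D}"]) (use assms in \<open>auto simp: mult.commute\<close>)

lemma abs_le_sup_norm: "i < nS D \<Longrightarrow> \<bar>u i\<bar> \<le> sup_norm D u"
  unfolding sup_norm_def by (rule Max_ge) auto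

lemma sup_norm_le_iff: "0 < nS D \<Longrightarrow> sup_norm D u \<le> b \<longleftrightarrow> (\<forall>i<nS D. \<bar>u i\<bar> \<le> b)"
  unfolding sup_norm_def by (subst Max_le_iff) auto

lemma sup_norm_nonneg: "0 < nS D \<Longrightarrow> 0 \<le> sup_norm D u"
  by (rule order_trans[OF abs_ge_zero abs_le_sup_norm])

text \<open>Each term lies in an interval of length 2b, so Hoeffding's exponent is 2 (n
  \<epsilon>)^2 / (n (2b)^2).\<close>

lemma prob_average_replicate_pmf_le:
  fixes u :: "'a \<Rightarrow> real"
  assumes bound: "\<And>j. j \<in> set_pmf p \<Longrightarrow> \<bar>u j\<bar> \<le> b" and "0 < b" "0 < \<epsilon>" "0 < n"
  shows "measure_pmf.prob (map_pmf (\<lambda>js. (\<Sum>j\<leftarrow>js. u j) / real n) (replicate_pmf n p))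
           {y. \<epsilon> \<le> \<bar>y - measure_pmf.expectation p u\<bar>} \<le> 2 * exp (- (real n * \<epsilon>\<^sup>2 / (2 * b\<^sup>2)))"
proof -
  define d :: 'a where "d = undefined"
  let ?P = "Pi_pmf {..<n} d (\<lambda>_. p)"
  interpret Hoeffding_ineq "measure_pmf ?P" "{..<n}" "\<lambda>i f. u (f i)" "\<lambda>_. - b" "\<lambda>_. b"
    "real n * measure_pmf.expectation p u"
  proof unfold_locales
    show "prob_space.indep_vars ?P (\<lambda>_. borel) (\<lambda>i f. u (f i)) {..<n}"
      by (rule prob_space.indep_vars_compose2[OF prob_space_measure_pmf indep_vars_Pi_pmf]) auto
  next
    fix i assume i: "i \<in> {..<n}"
    show "AE f in measure_pmf ?P. u (f i) \<in> {- b..b}"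
    proof (rule AE_pmfI)
      fix f assume "f \<in> set_pmf ?P"
      hence "f i \<in> set_pmf p" using i by (auto simp: set_Pi_pmf PiE_dflt_def)
      from bound[OF this] show "u (f i) \<in> {- b..b}" by auto
    qed
  next
    have "measure_pmf.expectation ?P (\<lambda>f. u (f i)) = measure_pmf.expectation p u" if "i < n" for i
    proof -
      have "measure_pmf.expectation ?P (\<lambda>f. u (f i)) =
            measure_pmf.expectation (map_pmf (\<lambda>f. f i) ?P) u" by simp
      also have "map_pmf (\<lambda>f. f i) ?P = p" using that by (subst Pi_pmf_component) auto
      finally show ?thesis .
    qed
    then show "real n * measure_pmf.expectation p u \<equiv>
                (\<Sum>i\<in>{..<n}. measure_pmf.expectation ?P (\<lambda>f. u (f i)))"
      by simp
  qed auto
  have eq: "map_pmf (\<lambda>js. (\<Sum>j\<leftarrow>js. u j) / real n) (replicate_pmf n p) =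
        map_pmf (\<lambda>f. (\<Sum>i<n. u (f i)) / real n) ?P"
    using arg_cong[OF map_sum_list_replicate_pmf[of u n p d], of "map_pmf (\<lambda>s. s / real n)"]
    by (simp add: map_pmf_comp)
  have "measure_pmf.prob (map_pmf (\<lambda>js. (\<Sum>j\<leftarrow>js. u j) / real n) (replicate_pmf n p))
           {y. \<epsilon> \<le> \<bar>y - measure_pmf.expectation p u\<bar>} =
        measure_pmf.prob ?P {f \<in> space ?P. real n * \<epsilon> \<le> \<bar>(\<Sum>i<n. u (f i)) - real n * measure_pmf.expectation p u\<bar>}"
    unfolding eq using \<open>0 < n\<close>
    by (auto simp: vimage_def field_simps abs_if intro!: arg_cong[where f = "measure_pmf.prob ?P"])
  also have "\<dots> \<le> 2 * exp (- 2 * (real n * \<epsilon>)\<^sup>2 / (\<Sum>i<n. (b - - b)\<^sup>2))"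
    using \<open>0 < n\<close> \<open>0 < b\<close> \<open>0 < \<epsilon>\<close> by (intro Hoeffding_ineq_abs_ge) auto
  also have "- 2 * (real n * \<epsilon>)\<^sup>2 / (\<Sum>i<n. (b - - b)\<^sup>2) = - (real n * \<epsilon>\<^sup>2 / (2 * b\<^sup>2))"
    using \<open>0 < n\<close> \<open>0 < b\<close> by (simp add: field_simps power2_eq_square)
  finally show ?thesis .
qed

text \<open>For a positive norm, the sample count is the least one that brings Hoeffding's bound
  down to \<delta>. A vanishing norm is a case of its own, because no sample is drawn then.\<close>

lemma ApxTrans_error:
  assumes supp: "set_pmf (trans_pmf D i a) \<subseteq> {..<nS D}" and "0 < \<epsilon>" "0 < \<delta>" "\<delta> < 1"
  shows "measure_pmf.prob (ApxTrans D u (sup_norm D u) i a \<epsilon> \<delta>)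
           {y. \<epsilon> < \<bar>y - expected_val D u i a\<bar>} \<le> \<delta>"
proof -
  define b where "b = sup_norm D u"
  define m where "m = nat \<lceil>2 * b\<^sup>2 / \<epsilon>\<^sup>2 * ln (2 / \<delta>)\<rceil>"
  define p where "p = trans_pmf D i a"
  have E: "expected_val D u i a = measure_pmf.expectation p u"
    using supp by (simp add: expected_val_eq_expectation p_def)
  have bound: "\<bar>u j\<bar> \<le> b" if "j \<in> set_pmf p" for j
    using that supp unfolding b_def p_def by (intro abs_le_sup_norm) auto
  have b0: "0 \<le> b"
    using set_pmf_not_empty[of p] bound by (meson abs_ge_zero all_not_in_conv order_trans)
  have ln_pos: "0 < ln (2 / \<delta>)" using assms by (simp add: ln_gt_zero)
  have apx: "ApxTrans D u (sup_norm D u) i a \<epsilon> \<delta> =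
             map_pmf (\<lambda>js. (\<Sum>j\<leftarrow>js. u j) / real m) (replicate_pmf m p)"
    by (simp add: ApxTrans_def Let_def m_def b_def p_def)
  show ?thesis
  proof (cases "b = 0")
    case True
    \<comment> \<open>The empty average is 0 / 0 = 0, which is exact because \<open>u\<close>
      vanishes on the support.\<close>
    hence "m = 0" by (simp add: m_def)
    moreover have "measure_pmf.expectation p u = measure_pmf.expectation p (\<lambda>_. 0)"
      using bound True by (intro Bochner_Integration.integral_cong_AE) (auto simp: AE_measure_pmf_iff)
    ultimately have "ApxTrans D u (sup_norm D u) i a \<epsilon> \<delta> = return_pmf 0" "expected_val D u i a = 0"
      by (auto simp: apx E)
    with assms show ?thesis by (simp add: measure_return_pmf)
  next
    case False
    with b0 have b: "0 < b" by simp
    have pos: "0 < 2 * b\<^sup>2 / \<epsilon>\<^sup>2 * ln (2 / \<delta>)" using b ln_pos assms by simp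
    hence m: "2 * b\<^sup>2 / \<epsilon>\<^sup>2 * ln (2 / \<delta>) \<le> real m" "0 < m"
      unfolding m_def by linarith+
    have "measure_pmf.prob (ApxTrans D u (sup_norm D u) i a \<epsilon> \<delta>)
           {y. \<epsilon> < \<bar>y - expected_val D u i a\<bar>} \<le>
          measure_pmf.prob (ApxTrans D u (sup_norm D u) i a \<epsilon> \<delta>)
           {y. \<epsilon> \<le> \<bar>y - measure_pmf.expectation p u\<bar>}"
      unfolding E by (intro measure_pmf.finite_measure_mono) auto
    also have "\<dots> \<le> 2 * exp (- (real m * \<epsilon>\<^sup>2 / (2 * b\<^sup>2)))"
      unfolding apx using bound b assms m by (intro prob_average_replicate_pmf_le) auto
    also have "\<dots> \<le> 2 * exp (- ln (2 / \<delta>))"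
      using m b assms by (simp add: field_simps)
    also have "\<dots> = \<delta>" using assms by (simp add: exp_minus)
    finally show ?thesis .
  qed
qed

section \<open>Error of a single round\<close>

text \<open>Union bound for two stages of which the second depends on the first: the failure
  probability is estimated by 1 on \<open>B\<close> and by \<open>c\<close> off \<open>B\<close>.
  This is the form that an adaptive iteration requires.\<close>

lemma prob_bind_pmf_le:
  assumes "measure_pmf.prob p B \<le> b" and "\<And>x. x \<in> set_pmf p - B \<Longrightarrow> measure_pmf.prob (f x) C \<le> c"
    and "0 \<le> c"
  shows "measure_pmf.prob (bind_pmf p f) C \<le> b + c"
proof -
  have "emeasure (bind_pmf p f) C = (\<integral>\<^sup>+x. emeasure (f x) C \<partial>p)"
    by (rule emeasure_bind_pmf)
  also have "\<dots> \<le> (\<integral>\<^sup>+x. indicator B x + ennreal c \<partial>p)"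
  proof (intro nn_integral_mono_AE AE_pmfI)
    fix x assume x: "x \<in> set_pmf p"
    show "emeasure (f x) C \<le> indicator B x + ennreal c"
    proof (cases "x \<in> B")
      case True
      then show ?thesis using measure_pmf.emeasure_le_1[of "f x" C]
        by (simp add: add_increasing2)
    next
      case False
      with assms(2)[of x] x show ?thesis
        by (simp add: measure_pmf.emeasure_eq_measure ennreal_leI)
    qed
  qed
  also have "\<dots> = emeasure p B + ennreal c"
    by (subst nn_integral_add) auto
  also have "\<dots> \<le> ennreal (b + c)"
    using assms(1,3) by (subst ennreal_plus) (auto simp: measure_pmf.emeasure_eq_measure
        intro!: ennreal_leI add_mono order_trans[OF measure_nonneg assms(1)])
  finally show ?thesis
    using order_trans[OF measure_nonneg assms(1)] assms(3)
    by (simp add: measure_pmf.emeasure_eq_measure ennreal_le_iff flip: ennreal_plus)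
qed

text \<open>Maxima are 1-Lipschitz for the sup distance. This serves both the contraction property
  and the comparison of sampled with exact Q-values.\<close>

lemma abs_Max_image_diff_le:
  fixes f g :: "'a \<Rightarrow> real"
  assumes "finite A" "A \<noteq> {}" and "\<And>a. a \<in> A \<Longrightarrow> \<bar>f a - g a\<bar> \<le> e"
  shows "\<bar>Max (f ` A) - Max (g ` A)\<bar> \<le> e"
proof -
  have le: "Max (h ` A) \<le> Max (k ` A) + e" if "\<And>a. a \<in> A \<Longrightarrow> \<bar>h a - k a\<bar> \<le> e" for h k :: "'a \<Rightarrow> real"
  proof (subst Max_le_iff; (use assms in simp)?)
    show "\<forall>a\<in>A. h a \<le> Max (k ` A) + e"
    proof
      fix a assume a: "a \<in> A"
      hence "k a \<le> Max (k ` A)" using assms by simp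
      with that[OF a] show "h a \<le> Max (k ` A) + e" by linarith
    qed
  qed
  from le[of f g] le[of g f] assms(3) show ?thesis by (force simp: abs_minus_commute abs_le_iff)
qed

lemma expected_val_diff:
  "expected_val D (\<lambda>j. u j - w j) i a = expected_val D u i a - expected_val D w i a"
  by (simp add: expected_val_def algebra_simps sum_subtractf)

text \<open>The vector \<open>u\<close> is arbitrary, so the bound applies to a random iterate after
  conditioning. The event concerns the value component only, hence \<open>pick\<close> may be any
  function.\<close>

lemma ApxVal_error:
  assumes D: "is_dmdp D M" and "0 < \<epsilon>" "0 < \<delta>" "\<delta> < 1"
  shows "measure_pmf.prob (ApxVal pick D u v0 (expected_val D v0) \<epsilon> \<delta>)
           {(v, \<pi>). \<exists>i<nS D. discount D * \<epsilon> < \<bar>v i - value_op D u i\<bar>} \<le> \<delta>"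
proof -
  define w where "w = (\<lambda>j. u j - v0 j)"
  define N where "N = nS D * nA D"
  define I where "I = {..<nS D} \<times> {..<nA D}"
  define q where "q = (\<lambda>(i, a). ApxTrans D w (sup_norm D w) i a \<epsilon> (\<delta> / real N))"
  define P where "P = Pi_pmf I 0 q"
  define bad where "bad = (\<lambda>(i, a). {y. \<epsilon> < \<bar>y - expected_val D w i a\<bar>})"
  define Q where "Q = (\<lambda>Y i a. reward D i a + discount D * (expected_val D v0 i a + Y (i, a)))"
  define R where "R = (\<lambda>Y. (\<lambda>i. if i < nS D then Max (Q Y i ` {..<nA D}) else 0,
                            \<lambda>i. if i < nS D then pick {a. is_arg_max (Q Y i) (\<lambda>a. a < nA D) a} else 0))"
  have N: "1 \<le> real N" using D by (simp add: N_def is_dmdp_def Suc_le_eq flip: of_nat_mult)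
  have apx: "ApxVal pick D u v0 (expected_val D v0) \<epsilon> \<delta> = map_pmf R P"
    unfolding ApxVal_def Let_def P_def q_def w_def R_def Q_def map_pmf_def I_def N_def by simp
  \<comment> \<open>Only the marginals of the product enter, each at confidence \<delta>/N; the
    union bound over \<open>I\<close> adds up to \<delta>.\<close>
  have comp: "measure_pmf.prob P {Y. Y k \<in> bad k} \<le> \<delta> / real N" if "k \<in> I" for k
  proof -
    obtain i a where k: "k = (i, a)" by fastforce
    have "measure_pmf.prob P {Y. Y k \<in> bad k} = measure_pmf.prob (map_pmf (\<lambda>Y. Y k) P) (bad k)"
      by (simp add: vimage_def)
    also have "map_pmf (\<lambda>Y. Y k) P = q k"
      unfolding P_def using that by (subst Pi_pmf_component) (auto simp: I_def)
    also have "measure_pmf.prob (q k) (bad k) \<le> \<delta> / real N"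
      unfolding k q_def bad_def prod.case
    proof (rule ApxTrans_error)
      have "\<delta> / real N \<le> \<delta> / 1" using N assms by (intro divide_left_mono) auto
      thus "\<delta> / real N < 1" using assms by simp
    qed (use that D N assms in \<open>auto simp: k I_def is_dmdp_def\<close>)
    finally show ?thesis .
  qed
  have good: "\<forall>i<nS D. \<bar>fst (R Y) i - value_op D u i\<bar> \<le> discount D * \<epsilon>"
    if Y: "\<forall>k\<in>I. Y k \<notin> bad k" for Y
  proof (intro allI impI)
    fix i assume i: "i < nS D"
    have "\<bar>Max (Q Y i ` {..<nA D}) - Max ((\<lambda>a. reward D i a + discount D * expected_val D u i a) ` {..<nA D})\<bar>
             \<le> discount D * \<epsilon>"
    proof (rule abs_Max_image_diff_le)
      fix a assume "a \<in> {..<nA D}"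
      hence "\<bar>Y (i, a) - expected_val D w i a\<bar> \<le> \<epsilon>"
        using Y i by (force simp: I_def bad_def)
      \<comment> \<open>The reference values at \<open>v0\<close> are exact and
        \<open>expected_val\<close> is linear, so only the sampling error for
        \<open>w = u - v0\<close> survives, scaled by the discount.\<close>
      moreover have "Q Y i a - (reward D i a + discount D * expected_val D u i a) =
                     discount D * (Y (i, a) - expected_val D w i a)"
        by (simp add: Q_def w_def expected_val_diff algebra_simps)
      ultimately show "\<bar>Q Y i a - (reward D i a + discount D * expected_val D u i a)\<bar> \<le> discount D * \<epsilon>"
        using D by (simp add: abs_mult is_dmdp_def)
    qed (use D in \<open>auto simp: is_dmdp_def\<close>)
    thus "\<bar>fst (R Y) i - value_op D u i\<bar> \<le> discount D * \<epsilon>"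
      using i by (simp add: R_def value_op_def)
  qed
  have "measure_pmf.prob (ApxVal pick D u v0 (expected_val D v0) \<epsilon> \<delta>)
           {(v, \<pi>). \<exists>i<nS D. discount D * \<epsilon> < \<bar>v i - value_op D u i\<bar>} =
        measure_pmf.prob P {Y. \<exists>i<nS D. discount D * \<epsilon> < \<bar>fst (R Y) i - value_op D u i\<bar>}"
    by (simp add: apx vimage_def case_prod_beta)
  also have "\<dots> \<le> measure_pmf.prob P (\<Union>k\<in>I. {Y. Y k \<in> bad k})"
    using good by (intro measure_pmf.finite_measure_mono) (force simp: not_le)+
  also have "\<dots> \<le> (\<Sum>k\<in>I. measure_pmf.prob P {Y. Y k \<in> bad k})"
    by (intro measure_UNION_le) (auto simp: I_def)
  also have "\<dots> \<le> (\<Sum>k\<in>I. \<delta> / real N)" by (intro sum_mono comp)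
  also have "\<dots> = \<delta>" using N by (simp add: I_def flip: N_def of_nat_mult)
  finally show ?thesis .
qed

section \<open>Contraction and the optimal value\<close>

lemma expected_val_bound:
  assumes "set_pmf (trans_pmf D i a) \<subseteq> {..<nS D}" and "\<And>j. j < nS D \<Longrightarrow> \<bar>u j\<bar> \<le> b"
  shows "\<bar>expected_val D u i a\<bar> \<le> b"
proof -
  have "\<bar>expected_val D u i a\<bar> \<le> (\<Sum>j<nS D. pmf (trans_pmf D i a) j * \<bar>u j\<bar>)"
    unfolding expected_val_def by (rule order_trans[OF sum_abs]) (simp add: abs_mult)
  also have "\<dots> \<le> (\<Sum>j<nS D. pmf (trans_pmf D i a) j * b)"
    using assms by (intro sum_mono mult_left_mono) auto
  also have "\<dots> = b"
    using sum_pmf_eq_1[OF _ assms(1)] by (simp flip: sum_distrib_right)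
  finally show ?thesis .
qed

text \<open>Stated for every index and not just for states: outside S both values are 0. This lets
  fixed points be compared as functions.\<close>

lemma value_op_contraction:
  assumes D: "is_dmdp D M" and uw: "\<And>j. j < nS D \<Longrightarrow> \<bar>u j - w j\<bar> \<le> b" and "0 \<le> b"
  shows "\<bar>value_op D u i - value_op D w i\<bar> \<le> discount D * b"
proof (cases "i < nS D")
  case True
  have "\<bar>Max ((\<lambda>a. reward D i a + discount D * expected_val D u i a) ` {..<nA D}) -
         Max ((\<lambda>a. reward D i a + discount D * expected_val D w i a) ` {..<nA D})\<bar> \<le> discount D * b"
  proof (rule abs_Max_image_diff_le)
    fix a assume a: "a \<in> {..<nA D}"
    have "\<bar>expected_val D (\<lambda>j. u j - w j) i a\<bar> \<le> b"
      using D True a uw by (intro expected_val_bound) (auto simp: is_dmdp_def)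
    hence "\<bar>discount D * expected_val D (\<lambda>j. u j - w j) i a\<bar> \<le> discount D * b"
      using D by (simp add: abs_mult is_dmdp_def)
    thus "\<bar>reward D i a + discount D * expected_val D u i a -
           (reward D i a + discount D * expected_val D w i a)\<bar> \<le> discount D * b"
      by (simp add: expected_val_diff algebra_simps)
  qed (use D in \<open>auto simp: is_dmdp_def\<close>)
  with True show ?thesis by (simp add: value_op_def)
qed (use assms in \<open>simp add: value_op_def is_dmdp_def\<close>)

lemma abs_value_op_zero_le:
  assumes "is_dmdp D M"
  shows "\<bar>value_op D (\<lambda>_. 0) i\<bar> \<le> M"
proof (cases "i < nS D")
  case True
  have "Max (reward D i ` {..<nA D}) \<in> reward D i ` {..<nA D}"
    using assms by (intro Max_in) (auto simp: is_dmdp_def)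
  hence "Max (reward D i ` {..<nA D}) \<in> {-M..M}"
    using assms True by (force simp: is_dmdp_def)
  thus ?thesis using True by (simp add: value_op_def expected_val_def abs_le_iff)
qed (use assms in \<open>simp add: value_op_def is_dmdp_def\<close>)

text \<open>Value iteration from 0: consecutive iterates differ by at most M g^n, so the telescoping
  series converges at each index, and the limit is fixed by continuity of the operator.\<close>

lemma value_op_fixed_point_exists:
  assumes D: "is_dmdp D M"
  shows "\<exists>v. value_op D v = v"
proof -
  define g where "g = discount D"
  have g: "0 < g" "g < 1" and M: "0 < M" using D by (auto simp: g_def is_dmdp_def)
  define T where "T n = (value_op D ^^ n) (\<lambda>_. 0)" for n
  have step: "\<bar>T (Suc n) i - T n i\<bar> \<le> M * g ^ n" for n i
  proof (induction n arbitrary: i)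
    case 0
    show ?case using abs_value_op_zero_le[OF D, of i] by (simp add: T_def)
  next
    case (Suc n)
    have "\<bar>value_op D (T (Suc n)) i - value_op D (T n) i\<bar> \<le> discount D * (M * g ^ n)"
      using M g by (intro value_op_contraction[OF D] Suc.IH) auto
    thus ?case by (simp add: T_def g_def mult_ac)
  qed
  have conv: "convergent (\<lambda>n. T n i)" for i
  proof -
    have "summable (\<lambda>n. T (Suc n) i - T n i)"
      by (rule summable_comparison_test[where g = "\<lambda>n. M * g ^ n"])
         (use step g in \<open>auto intro!: summable_mult summable_geometric\<close>)
    hence "(\<lambda>n. \<Sum>k<n. T (Suc k) i - T k i) \<longlonglongrightarrow> (\<Sum>n. T (Suc n) i - T n i)"
      by (rule summable_LIMSEQ)
    hence "(\<lambda>n. T n i - T 0 i) \<longlonglongrightarrow> (\<Sum>n. T (Suc n) i - T n i)"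
      by (simp only: sum_lessThan_telescope[of "\<lambda>n. T n i"])
    from tendsto_add[OF this tendsto_const[of "T 0 i"]] show ?thesis
      by (auto simp: convergent_def)
  qed
  define v where "v i = lim (\<lambda>n. T n i)" for i
  have lim: "(\<lambda>n. T n i) \<longlonglongrightarrow> v i" for i
    using conv[of i] by (simp add: v_def convergent_LIMSEQ_iff)
  have "value_op D v i = v i" for i
  proof (rule LIMSEQ_unique)
    show "(\<lambda>n. T (Suc n) i) \<longlonglongrightarrow> v i" using lim[of i] by (rule LIMSEQ_Suc)
    \<comment> \<open>A finite sum of pointwise errors dominates the sup distance on S and still
      tends to 0; it turns pointwise convergence into a bound to which the contraction
      applies.\<close>
    define e where "e n = (\<Sum>j<nS D. \<bar>T n j - v j\<bar>)" for n
    have e: "e \<longlonglongrightarrow> 0"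
      unfolding e_def by (rule tendsto_eq_intros tendsto_rabs lim refl | simp)+
    have bd: "\<bar>T (Suc n) i - value_op D v i\<bar> \<le> g * e n" for n
    proof -
      have "\<bar>value_op D (T n) i - value_op D v i\<bar> \<le> discount D * e n"
        unfolding e_def by (intro value_op_contraction[OF D])
          (auto intro: member_le_sum[where f = "\<lambda>j. \<bar>T n j - v j\<bar>"] sum_nonneg)
      thus ?thesis by (simp add: T_def g_def)
    qed
    have "(\<lambda>n. g * e n) \<longlonglongrightarrow> 0" using tendsto_mult[OF tendsto_const e, of g] by simp
    hence "(\<lambda>n. T (Suc n) i - value_op D v i) \<longlonglongrightarrow> 0"
      by (rule Lim_null_comparison[rotated]) (simp add: bd)
    thus "(\<lambda>n. T (Suc n) i) \<longlonglongrightarrow> value_op D v i" by (rule LIM_zero_cancel)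
  qed
  thus ?thesis by blast
qed

lemma value_op_fixed_point_unique:
  assumes D: "is_dmdp D M" and "value_op D v = v" "value_op D w = w"
  shows "v = w"
proof -
  have pos: "0 < nS D" "discount D < 1" using D by (auto simp: is_dmdp_def)
  define b where "b = sup_norm D (\<lambda>i. v i - w i)"
  have b: "0 \<le> b" unfolding b_def by (rule sup_norm_nonneg[OF pos(1)])
  have "\<bar>value_op D v i - value_op D w i\<bar> \<le> discount D * b" for i
    using abs_le_sup_norm[of _ D "\<lambda>i. v i - w i"] b
    by (intro value_op_contraction[OF D]) (auto simp: b_def)
  hence le: "\<bar>v i - w i\<bar> \<le> discount D * b" for i using assms by simp
  hence "b \<le> discount D * b" unfolding b_def sup_norm_le_iff[OF pos(1)] by blast
  hence "b * (1 - discount D) \<le> 0" by (simp add: algebra_simps)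
  \<comment> \<open>\<open>le\<close> holds at every index, so distance 0 on S yields equality as
    functions.\<close>
  with b pos have "b = 0" by (simp add: mult_le_0_iff)
  with le show ?thesis by auto
qed

lemma value_op_opt_val:
  assumes "is_dmdp D M"
  shows "value_op D (opt_val D) = opt_val D"
proof -
  have "\<exists>!v. value_op D v = v"
    using value_op_fixed_point_exists[OF assms] value_op_fixed_point_unique[OF assms] by blast
  thus ?thesis unfolding opt_val_def by (rule theI')
qed

text \<open>Comparison with the vector 0 gives b \<le> M + \<gamma> b for the norm \<open>b\<close>.
  The result is the initial error of an iteration started at 0.\<close>

lemma abs_opt_val_le:
  assumes D: "is_dmdp D M" and "i < nS D"
  shows "\<bar>opt_val D i\<bar> \<le> M / (1 - discount D)"
proof -
  have pos: "0 < nS D" "discount D < 1" using D by (auto simp: is_dmdp_def)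
  define b where "b = sup_norm D (opt_val D)"
  have b: "0 \<le> b" unfolding b_def by (rule sup_norm_nonneg[OF pos(1)])
  have "\<bar>opt_val D i\<bar> \<le> M + discount D * b" for i
  proof -
    have "\<bar>value_op D (opt_val D) i - value_op D (\<lambda>_. 0) i\<bar> \<le> discount D * b"
      using b by (intro value_op_contraction[OF D]) (auto simp: b_def abs_le_sup_norm)
    with abs_value_op_zero_le[OF D, of i] value_op_opt_val[OF D] show ?thesis
      by simp
  qed
  hence "b \<le> M + discount D * b" unfolding b_def sup_norm_le_iff[OF pos(1)] by blast
  hence "b \<le> M / (1 - discount D)" using pos by (simp add: field_simps)
  with abs_le_sup_norm[of i D "opt_val D"] assms(2) show ?thesis by (simp add: b_def)
qed

section \<open>Error propagation over the rounds\<close>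

text \<open>Here \<delta> is the failure probability of one round. The error obeys e(l+1) = \<gamma>
  e(l) + \<gamma> \<epsilon>; the closed form is a decaying initial error plus the fixed point
  \<gamma> \<epsilon> / (1-\<gamma>) of this recursion.\<close>

lemma RandomizedVI_iter_error:
  assumes D: "is_dmdp D M" and "0 < \<epsilon>" "0 < \<delta>" "\<delta> < 1"
    and v0: "\<And>i. i < nS D \<Longrightarrow> \<bar>v0 i - opt_val D i\<bar> \<le> K"
  shows "measure_pmf.prob (RandomizedVI_iter pick D v0 (expected_val D v0) \<epsilon> \<delta> l)
           {(v, \<pi>). \<exists>i<nS D. discount D ^ l * K + discount D * \<epsilon> / (1 - discount D) < \<bar>v i - opt_val D i\<bar>}
         \<le> real l * \<delta>"
proof (induction l)
  case 0
  have "0 < discount D * \<epsilon> / (1 - discount D)" using assms by (simp add: is_dmdp_def)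
  thus ?case using v0 by (force simp: measure_return_pmf indicator_def)
next
  case (Suc l)
  define g where "g = discount D"
  have g: "0 < g" "g < 1" using D by (auto simp: g_def is_dmdp_def)
  have K: "0 \<le> K" using v0[of 0] D by (simp add: is_dmdp_def)
  define e where "e l = g ^ l * K + g * \<epsilon> / (1 - g)" for l
  have e: "e (Suc l) = g * e l + g * \<epsilon>"
    using g by (simp add: e_def field_simps)
  have e0: "0 \<le> e l" using g K assms by (simp add: e_def)
  define B where "B l = {(v, \<pi> :: nat \<Rightarrow> nat). \<exists>i<nS D. e l < \<bar>v i - opt_val D i\<bar>}" for l
  have "measure_pmf.prob (RandomizedVI_iter pick D v0 (expected_val D v0) \<epsilon> \<delta> (Suc l)) (B (Suc l))
        \<le> real l * \<delta> + \<delta>"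
    unfolding RandomizedVI_iter.simps
  proof (rule prob_bind_pmf_le[where B = "B l"])
    show "measure_pmf.prob (RandomizedVI_iter pick D v0 (expected_val D v0) \<epsilon> \<delta> l) (B l) \<le> real l * \<delta>"
      using Suc.IH by (simp add: B_def e_def g_def)
  next
    fix y assume y: "y \<in> set_pmf (RandomizedVI_iter pick D v0 (expected_val D v0) \<epsilon> \<delta> l) - B l"
    obtain u \<rho> where [simp]: "y = (u, \<rho>)" by fastforce
    have u: "\<bar>u i - opt_val D i\<bar> \<le> e l" if "i < nS D" for i using y that by (force simp: B_def)
    have "\<bar>value_op D u i - opt_val D i\<bar> \<le> g * e l" for i
      using value_op_contraction[OF D, of u "opt_val D" "e l" i] u e0
      by (simp add: value_op_opt_val[OF D] g_def)
    \<comment> \<open>Triangle inequality through \<open>value_op D u i\<close>: an error above g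
      e(l) + g \<epsilon> can only occur if the round misses the value operator by more than g
      \<epsilon>.\<close>
    hence "B (Suc l) \<subseteq> {(v, \<pi>). \<exists>i<nS D. discount D * \<epsilon> < \<bar>v i - value_op D u i\<bar>}"
      unfolding B_def e g_def[symmetric] by safe (smt (verit, best))
    hence "measure_pmf.prob (ApxVal pick D u v0 (expected_val D v0) \<epsilon> \<delta>) (B (Suc l)) \<le>
           measure_pmf.prob (ApxVal pick D u v0 (expected_val D v0) \<epsilon> \<delta>)
             {(v, \<pi>). \<exists>i<nS D. discount D * \<epsilon> < \<bar>v i - value_op D u i\<bar>}"
      by (intro measure_pmf.finite_measure_mono) auto
    also have "\<dots> \<le> \<delta>" using assms by (intro ApxVal_error[OF D])
    finally show "measure_pmf.prob (case y of (v, _) \<Rightarrow> ApxVal pick D v v0 (expected_val D v0) \<epsilon> \<delta>)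
                    (B (Suc l)) \<le> \<delta>" by simp
  qed (use assms in simp)
  thus ?case by (simp add: B_def e_def g_def algebra_simps)
qed

text \<open>The assumption \<epsilon> < M/(1-g) puts the argument of the logarithm above 1, so there
  is at least one round and \<delta>/L is a genuine probability. The decay rests on ln g \<le> g -
  1, that is, g^L \<le> exp (-L (1-g)).\<close>

lemma iteration_count:
  fixes M g \<epsilon> :: real
  assumes "0 < M" "0 < g" "g < 1" "0 < \<epsilon>" "\<epsilon> < M / (1 - g)"
  shows "1 \<le> nat \<lceil>1 / (1 - g) * ln (2 * M / ((1 - g)\<^sup>2 * \<epsilon>))\<rceil>"
    and "g ^ nat \<lceil>1 / (1 - g) * ln (2 * M / ((1 - g)\<^sup>2 * \<epsilon>))\<rceil> \<le> (1 - g)\<^sup>2 * \<epsilon> / (2 * M)"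
    and "0 < ln (2 * M / ((1 - g)\<^sup>2 * \<epsilon>))"
proof -
  define x where "x = 2 * M / ((1 - g)\<^sup>2 * \<epsilon>)"
  have "(1 - g) * \<epsilon> < M" using assms by (simp add: field_simps)
  moreover have "(1 - g)\<^sup>2 * \<epsilon> \<le> (1 - g) * \<epsilon>"
    using assms by (intro mult_right_mono) (auto simp: power2_eq_square mult_le_cancel_left2)
  ultimately have "(1 - g)\<^sup>2 * \<epsilon> < 2 * M" using assms by linarith
  hence x: "1 < x" using assms by (simp add: x_def)
  thus lnx: "0 < ln (2 * M / ((1 - g)\<^sup>2 * \<epsilon>))" by (simp add: x_def)
  define L where "L = nat \<lceil>1 / (1 - g) * ln x\<rceil>"
  have pos: "0 < 1 / (1 - g) * ln x" using assms lnx by (simp add: x_def)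
  have L: "1 / (1 - g) * ln x \<le> real L" "1 \<le> L" using pos unfolding L_def by linarith+
  thus "1 \<le> nat \<lceil>1 / (1 - g) * ln (2 * M / ((1 - g)\<^sup>2 * \<epsilon>))\<rceil>" by (simp add: L_def x_def)
  have "g ^ L = exp (real L * ln g)" using assms by (simp add: exp_of_nat_mult)
  also have "\<dots> \<le> exp (- ln x)"
  proof (subst exp_le_cancel_iff)
    have "ln g \<le> g - 1" using assms by (intro ln_le_minus_one) auto
    hence "real L * ln g \<le> real L * (g - 1)" by (intro mult_left_mono) auto
    also have "ln x \<le> real L * (1 - g)" using L assms by (simp add: field_simps)
    hence "real L * (g - 1) \<le> - ln x" by (simp add: algebra_simps)
    finally show "real L * ln g \<le> - ln x" .
  qed
  also have "\<dots> = 1 / x" using x by (simp add: exp_minus field_simps)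
  finally show "g ^ nat \<lceil>1 / (1 - g) * ln (2 * M / ((1 - g)\<^sup>2 * \<epsilon>))\<rceil> \<le> (1 - g)\<^sup>2 * \<epsilon> / (2 * M)"
    by (simp add: x_def L_def)
qed

lemma RandomizedVI_correct:
  fixes D M \<epsilon>
  defines "L \<equiv> nat \<lceil>1 / (1 - discount D) * ln (2 * M / ((1 - discount D)\<^sup>2 * \<epsilon>))\<rceil>"
  assumes D: "is_dmdp D M" and \<epsilon>: "0 < \<epsilon>" "\<epsilon> < M / (1 - discount D)" and \<delta>: "0 < \<delta>" "\<delta> < 1"
  shows "1 - \<delta> \<le> measure_pmf.prob
      (RandomizedVI pick D (\<lambda>_. 0) L ((1 - discount D) * \<epsilon> / (4 * discount D)) \<delta>)
      {(v, \<pi>). sup_norm D (\<lambda>i. v i - opt_val D i) \<le> \<epsilon>}" (is "_ \<le> measure_pmf.prob ?R ?G")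
proof -
  define g where "g = discount D"
  have g: "0 < g" "g < 1" and M: "0 < M" and nS: "0 < nS D"
    using D by (auto simp: g_def is_dmdp_def)
  define \<epsilon>' where "\<epsilon>' = (1 - g) * \<epsilon> / (4 * g)"
  have L: "1 \<le> L" "g ^ L \<le> (1 - g)\<^sup>2 * \<epsilon> / (2 * M)"
    unfolding L_def g_def[symmetric] using iteration_count[OF M g \<epsilon>[folded g_def]] by auto
  have bound: "g ^ L * (M / (1 - g)) + g * \<epsilon>' / (1 - g) \<le> \<epsilon>"
  proof -
    have "g ^ L * (M / (1 - g)) \<le> (1 - g)\<^sup>2 * \<epsilon> / (2 * M) * (M / (1 - g))"
      using L g M by (intro mult_right_mono) auto
    also have "\<dots> = (1 - g) * \<epsilon> / 2" using g M by (simp add: field_simps power2_eq_square)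
    also have "\<dots> \<le> \<epsilon> / 2" using g \<epsilon> by simp
    finally have "g ^ L * (M / (1 - g)) \<le> \<epsilon> / 2" .
    \<comment> \<open>The 4g in the accuracy parameter cancels the discount in front of the
      accumulated noise and leaves a quarter of \<epsilon>.\<close>
    moreover have "g * \<epsilon>' / (1 - g) = \<epsilon> / 4" using g by (simp add: \<epsilon>'_def field_simps)
    ultimately have "g ^ L * (M / (1 - g)) + g * \<epsilon>' / (1 - g) \<le> \<epsilon> / 2 + \<epsilon> / 4"
      by (intro add_mono) auto
    also have "\<dots> \<le> \<epsilon>" using \<epsilon> by simp
    finally show ?thesis .
  qed
  let ?B = "{(v, \<pi> :: nat \<Rightarrow> nat). \<exists>i<nS D. g ^ L * (M / (1 - g)) + g * \<epsilon>' / (1 - g) < \<bar>v i - opt_val D i\<bar>}"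
  have \<delta>L: "0 < \<delta> / real L" "\<delta> / real L < 1"
  proof -
    have "\<delta> / real L \<le> \<delta> / 1" using L \<delta> by (intro divide_left_mono) auto
    thus "\<delta> / real L < 1" using \<delta> by simp
  qed (use L \<delta> in simp)
  have "- ?G \<subseteq> ?B" using bound by (force simp: sup_norm_le_iff[OF nS] not_le)
  hence "measure_pmf.prob ?R (- ?G) \<le> measure_pmf.prob ?R ?B"
    by (intro measure_pmf.finite_measure_mono) auto
  also have "\<dots> \<le> real L * (\<delta> / real L)"
    unfolding RandomizedVI_def g_def[symmetric] \<epsilon>'_def[symmetric] unfolding g_def
    using \<epsilon> \<delta>L g abs_opt_val_le[OF D]
    by (intro RandomizedVI_iter_error[OF D]) (auto simp: \<epsilon>'_def)
  also have "\<dots> = \<delta>" using L by simp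
  finally show ?thesis
    using measure_pmf.prob_compl[of ?G ?R] by (simp add: Compl_eq_Diff_UNIV)
qed

section \<open>Coupling programs with distributions\<close>

text \<open>
  The store is coupled with the outcome of an abstract distribution \<open>P\<close>, while the running time is
  only bounded in expectation.  Every store in the support is related to some outcome of \<open>P\<close>, so
  \<open>R\<close> also serves as a postcondition, under which the time of the next command is bounded; no
  independence between stores and times is needed.
\<close>

definition refines :: "(store \<times> nat) pmf \<Rightarrow> 'a pmf \<Rightarrow> (store \<Rightarrow> 'a \<Rightarrow> bool) \<Rightarrow> nat \<Rightarrow> bool" where
  "refines X P R B \<longleftrightarrow> rel_pmf (\<lambda>x y. R (fst x) y) X P \<and> expected_time X \<le> of_nat B"

lemma refines_weaken:
  assumes "refines X P R B" "\<And>s y. R s y \<Longrightarrow> y \<in> set_pmf P \<Longrightarrow> R' s y" "B \<le> B'"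
  shows "refines X P R' B'"
proof -
  have "(of_nat B :: ennreal) \<le> of_nat B'" using assms(3) by simp
  moreover have "rel_pmf (\<lambda>x y. R' (fst x) y) X P"
    using assms(1) unfolding refines_def
    by (auto intro: pmf.rel_mono_strong[of "\<lambda>x y. R (fst x) y"] assms(2))
  ultimately show ?thesis using assms(1) unfolding refines_def by (auto intro: order_trans)
qed

lemma refines_return: "R s y \<Longrightarrow> t \<le> B \<Longrightarrow> refines (return_pmf (s, t)) (return_pmf y) R B"
  by (simp add: refines_def expected_time_def)

text \<open>Membership in the support of \<open>P\<close> is added to the relation, so facts about
  all possible outcomes, such as the boundedness of iterates, are available for the second command.
  Its time bound is uniform over these outcomes, hence expected times add.\<close>

lemma refines_bind:
  assumes X: "refines X P R1 B1"
    and f: "\<And>s y. R1 s y \<Longrightarrow> y \<in> set_pmf P \<Longrightarrow> refines (f s) (F y) R2 B2"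
  shows "refines (do {(s1, t1) \<leftarrow> X; (s2, t2) \<leftarrow> f s1; return_pmf (s2, t1 + t2)}) (bind_pmf P F) R2 (B1 + B2)"
proof -
  have rel: "rel_pmf (\<lambda>x y. R1 (fst x) y \<and> y \<in> set_pmf P) X P"
    using X unfolding refines_def
    by (auto intro: pmf.rel_mono_strong[of "\<lambda>x y. R1 (fst x) y"])
  have "rel_pmf (\<lambda>x y. R2 (fst x) y)
          (X \<bind> (\<lambda>(s1, t1). map_pmf (\<lambda>(s2, t2). (s2, t1 + t2)) (f s1))) (bind_pmf P F)"
    by (rule rel_pmf_bindI[OF rel])
       (use f in \<open>auto simp: refines_def pmf.rel_map case_prod_beta'\<close>)
  moreover have "expected_time (do {(s1, t1) \<leftarrow> X; (s2, t2) \<leftarrow> f s1; return_pmf (s2, t1 + t2)}) \<le> of_nat (B1 + B2)"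
  proof -
    have "expected_time (do {(s1, t1) \<leftarrow> X; (s2, t2) \<leftarrow> f s1; return_pmf (s2, t1 + t2)}) =
          (\<integral>\<^sup>+ x. of_nat (snd x) + expected_time (f (fst x)) \<partial>X)"
      by (simp add: expected_time_def case_prod_beta' nn_integral_add)
    also have "\<dots> \<le> (\<integral>\<^sup>+ x. of_nat (snd x) + of_nat B2 \<partial>X)"
    proof (intro nn_integral_mono_AE AE_pmfI add_left_mono)
      fix x assume x: "x \<in> set_pmf X"
      then obtain y where "R1 (fst x) y" "y \<in> set_pmf P"
        using rel_pmf_imp_rel_set[OF rel] by (auto simp: rel_set_def)
      from f[OF this] show "expected_time (f (fst x)) \<le> of_nat B2"
        by (simp add: refines_def)
    qed
    also have "\<dots> = expected_time X + of_nat B2"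
      by (simp add: expected_time_def nn_integral_add)
    also have "\<dots> \<le> of_nat (B1 + B2)"
      using X by (simp add: refines_def add_right_mono)
    finally show ?thesis .
  qed
  ultimately show ?thesis
    by (simp add: refines_def map_pmf_def case_prod_beta')
qed

lemma refines_tick:
  assumes "refines X P R B" "k + B \<le> B'"
  shows "refines (do {(s, t) \<leftarrow> X; return_pmf (s, k + t)}) P R B'"
proof -
  have "refines (do {(s, t) \<leftarrow> X; return_pmf (s, k + t)}) P R (k + B)"
    using assms(1)
    by (simp add: refines_def expected_time_def nn_integral_add case_prod_beta' pmf.rel_map
                  map_pmf_def[symmetric] add_left_mono)
  thus ?thesis by (rule refines_weaken) (use assms in auto)
qed

lemma refines_iterate:
  assumes "\<And>k s y. k < n \<Longrightarrow> I k s y \<Longrightarrow> y \<in> set_pmf (P k) \<Longrightarrow> refines (f k s) (F k y) (I (Suc k)) B"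
    and P0: "P 0 = return_pmf y0" and PS: "\<And>k. k < n \<Longrightarrow> P (Suc k) = bind_pmf (P k) (F k)"
    and I0: "I 0 s y0"
  shows "refines (iterate f n s) (P n) (I n) (n * B)"
  using assms(1) PS
proof (induction n)
  case 0
  show ?case using I0 by (auto simp: P0 intro: refines_return)
next
  case (Suc n)
  have "refines (iterate f n s) (P n) (I n) (n * B)"
    using Suc.prems by (intro Suc.IH) auto
  hence "refines (iterate f (Suc n) s) (bind_pmf (P n) (F n)) (I (Suc n)) (n * B + B)"
    unfolding iterate.simps by (rule refines_bind) (use Suc.prems in auto)
  thus ?case using Suc.prems(2)[of n] by (simp add: add.commute)
qed

text \<open>The abstract side is a family \<open>P k\<close>, the distribution after k rounds, with
  its own recursion. Thus \<open>replicate_pmf\<close>, \<open>fill_row\<close>, growing products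
  and \<open>RandomizedVI_iter\<close> all fit one rule. The 1 added to \<open>B\<close> pays for
  the loop step.\<close>

lemma refines_For:
  assumes step: "\<And>k s y. k < n \<Longrightarrow> I k s y \<Longrightarrow> y \<in> set_pmf (P k) \<Longrightarrow>
            refines (exec smp c (store_at x 0 (real k) s)) (F k y) (I (Suc k)) B"
    and P0: "P 0 = return_pmf y0" and PS: "\<And>k. k < n \<Longrightarrow> P (Suc k) = bind_pmf (P k) (F k)"
    and I0: "I 0 s y0" and n: "nval e s = n"
    and B: "1 + atime e + n * (1 + B) \<le> B'"
  shows "refines (exec smp (For x e c) s) (P n) (I n) B'"
proof -
  have "refines (iterate (\<lambda>k s'. do {
                      (s2, t2) \<leftarrow> exec smp c (store_at x 0 (real k) s');
                      return_pmf (s2, 1 + t2)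
                    }) n s) (P n) (I n) (n * (1 + B))"
  proof (rule refines_iterate[where F = F and P = P and ?y0.0 = y0])
    fix k s y assume "k < n" "I k s y" "y \<in> set_pmf (P k)"
    from refines_tick[OF step[OF this] order_refl, of 1]
    show "refines (do {
             (s2, t2) \<leftarrow> exec smp c (store_at x 0 (real k) s);
             return_pmf (s2, 1 + t2)
           }) (F k y) (I (Suc k)) (1 + B)" .
  qed (use P0 PS I0 in auto)
  from refines_tick[OF this B] show ?thesis by (simp add: n)
qed

lemma refines_Skip: "R s y \<Longrightarrow> 1 \<le> B \<Longrightarrow> refines (exec smp Skip s) (return_pmf y) R B"
  by (simp add: refines_return)

lemma refines_Assign:
  assumes "R (store_at x (nval e s) (aval e' s) s) y" "1 + atime e + atime e' \<le> B"
  shows "refines (exec smp (Assign x e e') s) (return_pmf y) R B"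
  using assms by (simp add: refines_return)

lemma refines_Seq:
  assumes "refines (exec smp c1 s) P R1 B1"
    and "\<And>s' y. R1 s' y \<Longrightarrow> y \<in> set_pmf P \<Longrightarrow> refines (exec smp c2 s') (F y) R2 B2"
    and "B1 + B2 \<le> B"
  shows "refines (exec smp (Seq c1 c2) s) (bind_pmf P F) R2 B"
  unfolding exec.simps by (rule refines_weaken[OF refines_bind[OF assms(1,2)]]) (use assms(3) in auto)

text \<open>For deterministic code: the first command is coupled with a point distribution and
  leaves no trace in \<open>P\<close>.\<close>

lemma refines_Seq_return:
  assumes "refines (exec smp c1 s) (return_pmf y) R1 B1"
    and "\<And>s'. R1 s' y \<Longrightarrow> refines (exec smp c2 s') P R2 B2"
    and "B1 + B2 \<le> B"
  shows "refines (exec smp (Seq c1 c2) s) P R2 B"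
proof -
  have "refines (exec smp (Seq c1 c2) s) (bind_pmf (return_pmf y) (\<lambda>_. P)) R2 B"
    by (rule refines_Seq[OF assms(1) _ assms(3)]) (use assms(2) in auto)
  thus ?thesis by (simp add: bind_return_pmf)
qed

lemma refines_Seq_Assign:
  assumes "refines (exec smp c (store_at x (nval e s) (aval e' s) s)) P R B1"
    and "1 + atime e + atime e' + B1 \<le> B"
  shows "refines (exec smp (Seq (Assign x e e') c) s) P R B"
proof (rule refines_Seq_return[OF _ _ assms(2)])
  show "refines (exec smp (Assign x e e') s) (return_pmf ())
          (\<lambda>s' _. s' = store_at x (nval e s) (aval e' s) s) (1 + atime e + atime e')"
    by (rule refines_Assign) auto
qed (use assms(1) in auto)

lemma refines_IfLe:
  assumes "aval e s \<le> aval e' s \<Longrightarrow> refines (exec smp c1 s) P R B1"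
    and "\<not> aval e s \<le> aval e' s \<Longrightarrow> refines (exec smp c2 s) P R B1"
    and "1 + atime e + atime e' + B1 \<le> B"
  shows "refines (exec smp (IfLe e e' c1 c2) s) P R B"
  unfolding exec.simps
  by (rule refines_tick[OF _ assms(3)]) (use assms(1,2) in auto)

lemma refines_map_pmf:
  "refines X P (\<lambda>s y. R s (f y)) B \<Longrightarrow> refines X (map_pmf f P) R B"
  by (simp add: refines_def pmf.rel_map)

text \<open>The oracle outcome (j, t) is coupled with \<open>j\<close> alone, and \<open>t\<close>
  enters through its mean; a correlation between the two does no harm.\<close>

lemma refines_Sample:
  assumes smp: "is_sampler D (real c) smp" and i: "nval e s = i" "i < nS D" and a: "nval e' s = a" "a < nA D"
    and R: "\<And>j. j \<in> set_pmf (trans_pmf D i a) \<Longrightarrow> R (store_at x 0 (real j) s) j"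
    and B: "1 + atime e + atime e' + c \<le> B"
  shows "refines (exec smp (Sample x e e') s) (trans_pmf D i a) R B"
proof -
  have fst: "trans_pmf D i a = map_pmf fst (smp i a)"
    and time: "(\<integral>\<^sup>+ jt. of_nat (snd jt) \<partial>measure_pmf (smp i a)) \<le> of_nat c"
    using smp i a by (auto simp: is_sampler_def simp flip: ennreal_of_nat_eq_real_of_nat)
  have "refines (exec smp (Sample x e e') s) (trans_pmf D i a) R (1 + atime e + atime e' + c)"
    unfolding refines_def
  proof
    show "rel_pmf (\<lambda>x. R (fst x)) (exec smp (Sample x e e') s) (trans_pmf D i a)"
      using R unfolding fst exec.simps i a
      by (auto simp: case_prod_beta' map_pmf_def[symmetric] pmf.rel_map intro!: rel_pmf_reflI)
    show "expected_time (exec smp (Sample x e e') s) \<le> of_nat (1 + atime e + atime e' + c)"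
      using time by (simp add: expected_time_def i a case_prod_beta' nn_integral_add add_left_mono)
  qed
  thus ?thesis by (rule refines_weaken) (use B in auto)
qed

section \<open>Cells and frame conditions\<close>

lemma store_at_same: "store_at x k y s x = (s x)(k := y)"
  and store_at_other: "x' \<noteq> x \<Longrightarrow> store_at x k y s x' = s x'"
  by (simp_all add: store_at_def)

text \<open>Frame condition: \<open>X\<close> lists the arrays that may have been written. Arrays
  are treated as a whole; untouched cells within \<open>v\<close> and \<open>pi\<close> are stated
  separately.\<close>

definition agree :: "string set \<Rightarrow> store \<Rightarrow> store \<Rightarrow> bool" where
  "agree X s s' \<longleftrightarrow> (\<forall>x. x \<notin> X \<longrightarrow> s x = s' x)"

lemma agreeD: "agree X s s' \<Longrightarrow> x \<notin> X \<Longrightarrow> s x = s' x"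
  by (simp add: agree_def)

lemma agree_refl: "agree X s s"
  by (simp add: agree_def)

lemma agree_store_at: "x \<in> X \<Longrightarrow> agree X (store_at x k y s) s' \<longleftrightarrow> agree X s s'"
  by (auto simp: agree_def store_at_def)

lemma agree_trans: "agree X s s' \<Longrightarrow> agree Y s' s'' \<Longrightarrow> X \<subseteq> Z \<Longrightarrow> Y \<subseteq> Z \<Longrightarrow> agree Z s s''"
  unfolding agree_def by (metis subsetD)

section \<open>The program\<close>

abbreviation scalar :: "string \<Rightarrow> aexp" where
  "scalar x \<equiv> Read x (Const 0)"

definition sample_loop :: cmd where
  "sample_loop = For ''k'' (scalar ''m'')
     (Seq (Sample ''j'' (scalar ''i'') (scalar ''a''))
          (Assign ''sum'' (Const 0) (Add (scalar ''sum'') (Read ''u'' (scalar ''j'')))))"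

text \<open>\<open>replicate_pmf\<close> draws the head first, whereas the loop puts the newest
  sample in front of the older ones; independent draws commute.\<close>

lemma replicate_pmf_Suc_cons:
  "replicate_pmf (Suc n) p = replicate_pmf n p \<bind> (\<lambda>xs. map_pmf (\<lambda>x. x # xs) p)"
  unfolding replicate_pmf.simps map_pmf_def by (rule bind_commute_pmf)

text \<open>The abstract list holds the newest sample first, as the loop produces it. Here and
  below, the numeric time constants are generous round numbers.\<close>

lemma refines_sample_loop:
  assumes smp: "is_sampler D (real c) smp" and i: "s0 ''i'' 0 = real i" "i < nS D"
    and a: "s0 ''a'' 0 = real a" "a < nA D" and m: "s0 ''m'' 0 = real m"
    and sum: "s0 ''sum'' 0 = 0" and w: "\<And>j. j < nS D \<Longrightarrow> s0 ''u'' j = w j"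
    and supp: "set_pmf (trans_pmf D i a) \<subseteq> {..<nS D}"
  shows "refines (exec smp sample_loop s0) (replicate_pmf m (trans_pmf D i a))
           (\<lambda>s js. agree {''j'', ''k'', ''sum''} s s0 \<and> s ''sum'' 0 = (\<Sum>j\<leftarrow>js. w j))
           (m * (c + 30) + 10)"
  unfolding sample_loop_def
proof (rule refines_For[where F = "\<lambda>_ js. map_pmf (\<lambda>j. j # js) (trans_pmf D i a)" and B = "c + 20"
        and P = "\<lambda>k. replicate_pmf k (trans_pmf D i a)"
        and I = "\<lambda>_ s js. agree {''j'', ''k'', ''sum''} s s0 \<and> s ''sum'' 0 = (\<Sum>j\<leftarrow>js. w j)"])
  fix k s js assume I: "agree {''j'', ''k'', ''sum''} s s0 \<and> s ''sum'' 0 = (\<Sum>j\<leftarrow>js. w j)"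
  hence ag: "agree {''j'', ''k'', ''sum''} s s0" and s: "s ''sum'' 0 = (\<Sum>j\<leftarrow>js. w j)" by auto
  have [simp]: "s ''i'' = s0 ''i''" "s ''a'' = s0 ''a''" "s ''u'' = s0 ''u''"
    by (rule agreeD[OF ag]; simp)+
  show "refines (exec smp (Seq (Sample ''j'' (scalar ''i'') (scalar ''a''))
          (Assign ''sum'' (Const 0) (Add (scalar ''sum'') (Read ''u'' (scalar ''j'')))))
            (store_at ''k'' 0 (real k) s)) (map_pmf (\<lambda>j. j # js) (trans_pmf D i a))
          (\<lambda>s js. agree {''j'', ''k'', ''sum''} s s0 \<and> s ''sum'' 0 = (\<Sum>j\<leftarrow>js. w j)) (c + 20)"
    unfolding map_pmf_def
  proof (rule refines_Seq)
    show "refines (exec smp (Sample ''j'' (scalar ''i'') (scalar ''a'')) (store_at ''k'' 0 (real k) s))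
            (trans_pmf D i a)
            (\<lambda>s' j. j < nS D \<and> s' = store_at ''j'' 0 (real j) (store_at ''k'' 0 (real k) s)) (c + 10)"
      by (rule refines_Sample[OF smp])
         (use supp i a in \<open>auto simp: nval_def store_at_same store_at_other\<close>)
  next
    fix s' j assume "j < nS D \<and> s' = store_at ''j'' 0 (real j) (store_at ''k'' 0 (real k) s)"
    thus "refines (exec smp (Assign ''sum'' (Const 0) (Add (scalar ''sum'') (Read ''u'' (scalar ''j'')))) s')
         (return_pmf (j # js))
          (\<lambda>s js. agree {''j'', ''k'', ''sum''} s s0 \<and> s ''sum'' 0 = (\<Sum>j\<leftarrow>js. w j)) 10"
      using ag s w by (intro refines_Assign) (auto simp: nval_def store_at_same store_at_other agree_store_at)
  qed simp
qed (use m sum in \<open>auto simp: nval_def agree_refl replicate_pmf_Suc_cons algebra_simps simp del: replicate_pmf.simps(2)\<close>)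

text \<open>
  The cells \<open>v[i]\<close> and \<open>pi[i]\<close> after the first \<open>n\<close> actions.  Replacing the incumbent only on a
  strict improvement yields the least maximizer, that is the tie breaking rule \<open>Min\<close>.
\<close>

definition first_max :: "(nat \<Rightarrow> real) \<Rightarrow> nat \<Rightarrow> real \<Rightarrow> real \<Rightarrow> bool" where
  "first_max f n y p \<longleftrightarrow> n = 0 \<or>
     (\<exists>b<n. p = real b \<and> y = f b \<and> (\<forall>b'<n. f b' \<le> f b) \<and> (\<forall>b'<b. f b' < f b))"

lemma first_max_cong: "(\<And>b. b < n \<Longrightarrow> f b = g b) \<Longrightarrow> first_max f n y p \<longleftrightarrow> first_max g n y p"
  unfolding first_max_def by (smt (verit) less_trans)

lemma first_max_step:
  assumes "first_max f n y p"
  shows "n = 0 \<or> y < f n \<Longrightarrow> first_max f (Suc n) (f n) (real n)"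
    and "n \<noteq> 0 \<Longrightarrow> f n \<le> y \<Longrightarrow> first_max f (Suc n) y p"
  using assms unfolding first_max_def by (force simp: less_Suc_eq)+

lemma first_max_imp:
  assumes "first_max f n y p" "0 < n"
  shows "y = Max (f ` {..<n})" and "p = real (Min {a. is_arg_max f (\<lambda>a. a < n) a})"
proof -
  from assms obtain b where b: "b < n" "p = real b" "y = f b" "\<forall>b'<n. f b' \<le> f b" "\<forall>b'<b. f b' < f b"
    by (auto simp: first_max_def)
  show "y = Max (f ` {..<n})" using b by (intro Max_eqI[symmetric]) auto
  have "Min {a. is_arg_max f (\<lambda>a. a < n) a} = b"
  proof (rule Min_eqI)
    show "finite {a. is_arg_max f (\<lambda>a. a < n) a}"
      by (rule finite_subset[of _ "{..<n}"]) (auto simp: is_arg_max_def)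
    show "b \<in> {a. is_arg_max f (\<lambda>a. a < n) a}"
      using b by (auto simp: is_arg_max_linorder)
    show "b \<le> a" if "a \<in> {a. is_arg_max f (\<lambda>a. a < n) a}" for a
      using that b by (force simp: is_arg_max_linorder not_le[symmetric])
  qed
  with b show "p = real (Min {a. is_arg_max f (\<lambda>a. a < n) a})" by simp
qed

definition record_action :: cmd where
  "record_action = Seq (Assign ''v'' (scalar ''i'') (scalar ''q'')) (Assign ''pi'' (scalar ''i'') (scalar ''a''))"

text \<open>The sum is divided by the sample count only here; for a count of 0 the machine and
  \<open>ApxTrans\<close> both read 0 / 0 = 0.\<close>

definition q_exp :: aexp where
  "q_exp = Add (Read ''r'' (Add (Mul (scalar ''i'') (scalar ''nA'')) (scalar ''a'')))
               (Mul (scalar ''gamma'') (Div (scalar ''sum'') (scalar ''m'')))"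

text \<open>Action 0 is recorded unconditionally, because \<open>v\<close> still holds the previous
  iterate at this state, which is no candidate for the maximum.\<close>

definition keep_best :: cmd where
  "keep_best = IfLe (scalar ''a'') (Const 0) record_action
     (IfLe (scalar ''q'') (Read ''v'' (scalar ''i'')) Skip record_action)"

definition action_step :: cmd where
  "action_step = Seq (Assign ''sum'' (Const 0) (Const 0))
     (Seq sample_loop (Seq (Assign ''q'' (Const 0) q_exp) keep_best))"

text \<open>The part of the input that is read inside the rounds; \<open>M\<close>,
  \<open>eps\<close> and \<open>delta\<close> are consumed before the main loop.\<close>

definition holds_mdp :: "dmdp \<Rightarrow> store \<Rightarrow> bool" where
  "holds_mdp D s \<longleftrightarrow> s ''nS'' 0 = real (nS D) \<and> s ''nA'' 0 = real (nA D) \<and> s ''gamma'' 0 = discount D \<and>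
     (\<forall>i<nS D. \<forall>a<nA D. s ''r'' (i * nA D + a) = reward D i a)"

lemma holds_mdp_agree:
  assumes "agree X s s'" "X \<inter> {''nS'', ''nA'', ''gamma'', ''r''} = {}"
  shows "holds_mdp D s \<longleftrightarrow> holds_mdp D s'"
proof -
  have "s ''nS'' = s' ''nS''" "s ''nA'' = s' ''nA''" "s ''gamma'' = s' ''gamma''" "s ''r'' = s' ''r''"
    by (rule agreeD[OF assms(1)]; use assms(2) in blast)+
  thus ?thesis by (simp add: holds_mdp_def)
qed

lemma nat_floor_index: "nat \<lfloor>real i * real n + real a\<rfloor> = i * n + a"
  by (metis floor_of_nat nat_int of_nat_add of_nat_mult)

definition action_vars :: "string set" where
  "action_vars = {''j'', ''k'', ''sum'', ''q'', ''v'', ''pi''}"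

text \<open>\<open>f\<close> holds the Q-values of the actions already treated, and the abstract
  outcome supplies its value at \<open>a\<close>. Accuracy, confidence and norm reach the program
  only as the count \<open>m\<close>, hence the hypothesis \<open>m_eq\<close>.\<close>

lemma refines_action_step:
  assumes smp: "is_sampler D (real c) smp" and s0: "holds_mdp D s0" and i: "s0 ''i'' 0 = real i" "i < nS D"
    and a: "s0 ''a'' 0 = real a" "a < nA D" and m: "s0 ''m'' 0 = real m"
    and w: "\<And>j. j < nS D \<Longrightarrow> s0 ''u'' j = w j"
    and supp: "set_pmf (trans_pmf D i a) \<subseteq> {..<nS D}"
    and fm: "first_max f a (s0 ''v'' i) (s0 ''pi'' i)"
    and m_eq: "m = nat \<lceil>2 * b\<^sup>2 / e\<^sup>2 * ln (2 / d)\<rceil>"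
  shows "refines (exec smp action_step s0) (ApxTrans D w b i a e d)
           (\<lambda>s y. agree action_vars s s0 \<and> (\<forall>i'. i' \<noteq> i \<longrightarrow> s ''v'' i' = s0 ''v'' i' \<and> s ''pi'' i' = s0 ''pi'' i')
              \<and> first_max (f(a := reward D i a + discount D * y)) (Suc a) (s ''v'' i) (s ''pi'' i))
           (m * (c + 30) + 100)"
proof -
  define s1 where "s1 = store_at ''sum'' 0 0 s0"
  define R where "R = (\<lambda>s y. agree action_vars s s0 \<and>
              (\<forall>i'. i' \<noteq> i \<longrightarrow> s ''v'' i' = s0 ''v'' i' \<and> s ''pi'' i' = s0 ''pi'' i')
              \<and> first_max (f(a := reward D i a + discount D * y)) (Suc a) (s ''v'' i) (s ''pi'' i))"
  have [simp]: "s1 ''i'' = s0 ''i''" "s1 ''a'' = s0 ''a''" "s1 ''u'' = s0 ''u''" "s1 ''m'' = s0 ''m''"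
     "s1 ''v'' = s0 ''v''" "s1 ''pi'' = s0 ''pi''" "s1 ''r'' = s0 ''r''" "s1 ''nA'' = s0 ''nA''"
     "s1 ''gamma'' = s0 ''gamma''"
    by (simp_all add: s1_def store_at_other)
  have apx: "ApxTrans D w b i a e d =
      replicate_pmf m (trans_pmf D i a) \<bind> (\<lambda>js. return_pmf ((\<Sum>j\<leftarrow>js. w j) / real m))"
    by (simp add: ApxTrans_def Let_def map_pmf_def m_eq)
  have s1: "store_at ''sum'' (nval (Const 0) s0) (aval (Const 0) s0) s0 = s1"
    by (simp add: s1_def nval_def)
  have "refines (exec smp (Seq sample_loop (Seq (Assign ''q'' (Const 0) q_exp) keep_best)) s1)
       (replicate_pmf m (trans_pmf D i a) \<bind> (\<lambda>js. return_pmf ((\<Sum>j\<leftarrow>js. w j) / real m)))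
       R (m * (c + 30) + 90)"
  proof (rule refines_Seq)
    show "refines (exec smp sample_loop s1) (replicate_pmf m (trans_pmf D i a))
         (\<lambda>s js. agree {''j'', ''k'', ''sum''} s s1 \<and> s ''sum'' 0 = (\<Sum>j\<leftarrow>js. w j)) (m * (c + 30) + 10)"
      by (rule refines_sample_loop[OF smp]) (use i a m w supp in \<open>auto simp: s1_def store_at_same store_at_other\<close>)
  next
    fix s js assume "agree {''j'', ''k'', ''sum''} s s1 \<and> s ''sum'' 0 = (\<Sum>j\<leftarrow>js. w j)"
    hence ag: "agree {''j'', ''k'', ''sum''} s s1" and sum: "s ''sum'' 0 = (\<Sum>j\<leftarrow>js. w j)" by auto
    have [simp]: "s ''i'' = s0 ''i''" "s ''a'' = s0 ''a''" "s ''m'' = s0 ''m''"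
       "s ''v'' = s0 ''v''" "s ''pi'' = s0 ''pi''" "s ''r'' = s0 ''r''" "s ''nA'' = s0 ''nA''"
       "s ''gamma'' = s0 ''gamma''"
      by (subst agreeD[OF ag]; simp)+
    have "agree {''j'', ''k'', ''sum''} s1 s0"
      by (simp add: s1_def agree_store_at agree_refl)
    hence ags: "agree action_vars s s0"
      by (rule agree_trans[OF ag]) (auto simp: action_vars_def)
    define y where "y = (\<Sum>j\<leftarrow>js. w j) / real m"
    define q where "q = reward D i a + discount D * y"
    define s2 where "s2 = store_at ''q'' 0 q s"
    have [simp]: "s2 ''q'' 0 = q" "s2 ''i'' = s0 ''i''" "s2 ''a'' = s0 ''a''" "s2 ''v'' = s0 ''v''" "s2 ''pi'' = s0 ''pi''"
      by (simp_all add: s2_def store_at_other store_at_same)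
    have ag2: "agree action_vars s2 s0" using ags by (simp add: s2_def agree_store_at action_vars_def)
    \<comment> \<open>Changing \<open>f\<close> at \<open>a\<close> leaves the running maximum over
      the actions below \<open>a\<close> intact.\<close>
    have fm': "first_max (f(a := q)) a (s0 ''v'' i) (s0 ''pi'' i)"
      using fm by (subst first_max_cong[of _ _ f]) auto
    have rec: "refines (exec smp record_action s2) (return_pmf y) R 10"
      if "a = 0 \<or> s0 ''v'' i < q"
      unfolding record_action_def using that ag2 first_max_step(1)[OF fm'] i a
      by (intro refines_Seq_Assign refines_Assign)
         (auto simp: R_def agree_store_at store_at_same store_at_other action_vars_def nval_def q_def[symmetric])
    have "refines (exec smp keep_best s2) (return_pmf y) R 50"
      unfolding keep_best_def
    proof (rule refines_IfLe)
      assume "aval (scalar ''a'') s2 \<le> aval (Const 0) s2"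
      with a have "a = 0" by simp
      thus "refines (exec smp record_action s2) (return_pmf y) R 30"
        by (intro refines_weaken[OF rec]) auto
    next
      assume "\<not> aval (scalar ''a'') s2 \<le> aval (Const 0) s2"
      hence a0: "a \<noteq> 0" using a by auto
      show "refines (exec smp (IfLe (scalar ''q'') (Read ''v'' (scalar ''i'')) Skip record_action) s2) (return_pmf y) R 30"
      proof (rule refines_IfLe)
        assume "aval (scalar ''q'') s2 \<le> aval (Read ''v'' (scalar ''i'')) s2"
        hence "q \<le> s0 ''v'' i" using i by auto
        with first_max_step(2)[OF fm' a0] ag2
        show "refines (exec smp Skip s2) (return_pmf y) R 10"
          by (intro refines_Skip) (auto simp: R_def q_def[symmetric])
      next
        assume "\<not> aval (scalar ''q'') s2 \<le> aval (Read ''v'' (scalar ''i'')) s2"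
        with i show "refines (exec smp record_action s2) (return_pmf y) R 10"
          by (intro rec) auto
      qed simp
    qed simp
    moreover have nA: "s0 ''nA'' 0 = real (nA D)" using s0 by (simp add: holds_mdp_def)
    have "s0 ''r'' (nat \<lfloor>s0 ''i'' 0 * s0 ''nA'' 0 + s0 ''a'' 0\<rfloor>) = reward D i a"
      unfolding i a nA nat_floor_index using s0 i a by (simp add: holds_mdp_def)
    hence "aval q_exp s = q"
      using s0 m by (simp add: q_def y_def q_exp_def holds_mdp_def sum)
    hence "store_at ''q'' (nval (Const 0) s) (aval q_exp s) s = s2"
      by (simp add: s2_def nval_def)
    ultimately show "refines (exec smp (Seq (Assign ''q'' (Const 0) q_exp) keep_best) s)
        (return_pmf ((\<Sum>j\<leftarrow>js. w j) / real m)) R 80"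
      unfolding y_def by (intro refines_Seq_Assign[where ?B1.0 = 50]) (simp_all add: q_exp_def)
  qed simp
  hence "refines (exec smp action_step s0) (ApxTrans D w b i a e d) R (m * (c + 30) + 100)"
    unfolding action_step_def apx by (intro refines_Seq_Assign[where ?B1.0 = "m * (c + 30) + 90"]) (simp_all only: s1, simp)
  thus ?thesis by (simp add: R_def)
qed

section \<open>Drawing the table of estimates row by row\<close>

text \<open>The sampling order of the inner loop: one action at a time, on top of a table
  \<open>Y\<close> whose other rows may already be drawn.\<close>

primrec fill_row :: "(nat \<times> nat \<Rightarrow> real pmf) \<Rightarrow> nat \<Rightarrow> nat \<Rightarrow> (nat \<times> nat \<Rightarrow> real) \<Rightarrow> (nat \<times> nat \<Rightarrow> real) pmf" where
  "fill_row q i 0 Y = return_pmf Y"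
| "fill_row q i (Suc a) Y = fill_row q i a Y \<bind> (\<lambda>Y. map_pmf (\<lambda>y. Y((i, a) := y)) (q (i, a)))"

text \<open>A product distribution can be drawn coordinate by coordinate; disjointness makes the
  entries of row \<open>i\<close> fresh.\<close>

lemma bind_fill_row:
  assumes "finite A" "A \<inter> {i} \<times> UNIV = {}"
  shows "Pi_pmf A 0 q \<bind> fill_row q i n = Pi_pmf (A \<union> {i} \<times> {..<n}) 0 q"
proof (induction n)
  case 0
  show ?case by (simp add: bind_return_pmf')
next
  case (Suc n)
  have "Pi_pmf A 0 q \<bind> fill_row q i (Suc n) =
        (Pi_pmf A 0 q \<bind> fill_row q i n) \<bind> (\<lambda>Y. map_pmf (\<lambda>y. Y((i, n) := y)) (q (i, n)))"
    unfolding bind_assoc_pmf by (intro bind_pmf_cong refl) simp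
  \<comment> \<open>The product rule draws the new coordinate first, \<open>fill_row\<close> draws
    it last; the two independent draws commute.\<close>
  also have "\<dots> = Pi_pmf (insert (i, n) (A \<union> {i} \<times> {..<n})) 0 q"
    unfolding Suc.IH map_pmf_def using assms
    by (subst bind_commute_pmf) (auto simp: Pi_pmf_insert' intro!: Pi_pmf_insert'[symmetric])
  also have "insert (i, n) (A \<union> {i} \<times> {..<n}) = A \<union> {i} \<times> {..<Suc n}" by auto
  finally show ?case .
qed

definition state_vars :: "string set" where
  "state_vars = insert ''a'' action_vars"

definition q_val :: "dmdp \<Rightarrow> (nat \<times> nat \<Rightarrow> real) \<Rightarrow> nat \<Rightarrow> nat \<Rightarrow> real" where
  "q_val D Y i a = reward D i a + discount D * Y (i, a)"

lemma q_val_fun_upd: "(q_val D Y i)(a := reward D i a + discount D * y) = q_val D (Y((i, a) := y)) i"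
  by (auto simp: q_val_def)

text \<open>That cells and Q-values of other states stay the same is part of the claim, because the
  outer loop has to keep the maxima found for earlier states.\<close>

lemma refines_state_step:
  assumes smp: "is_sampler D (real c) smp" and s0: "holds_mdp D s0" and i: "s0 ''i'' 0 = real i" "i < nS D"
    and m: "s0 ''m'' 0 = real m"
    and w: "\<And>j. j < nS D \<Longrightarrow> s0 ''u'' j = w j"
    and supp: "\<And>a. a < nA D \<Longrightarrow> set_pmf (trans_pmf D i a) \<subseteq> {..<nS D}"
    and m_eq: "m = nat \<lceil>2 * b\<^sup>2 / e\<^sup>2 * ln (2 / d)\<rceil>"
  defines "q \<equiv> \<lambda>(i, a). ApxTrans D w b i a e d"
  shows "refines (exec smp (For ''a'' (scalar ''nA'') action_step) s0) (fill_row q i (nA D) Y0)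
           (\<lambda>s Y. agree state_vars s s0 \<and>
              (\<forall>i'. i' \<noteq> i \<longrightarrow> s ''v'' i' = s0 ''v'' i' \<and> s ''pi'' i' = s0 ''pi'' i' \<and> q_val D Y i' = q_val D Y0 i')
              \<and> first_max (q_val D Y i) (nA D) (s ''v'' i) (s ''pi'' i))
           (nA D * (m * (c + 30) + 110) + 10)"
proof (rule refines_For[where ?y0.0 = Y0 and P = "\<lambda>a. fill_row q i a Y0" and B = "m * (c + 30) + 100"
      and F = "\<lambda>a Y. map_pmf (\<lambda>y. Y((i, a) := y)) (q (i, a))"
      and I = "\<lambda>a s Y. agree state_vars s s0 \<and>
              (\<forall>i'. i' \<noteq> i \<longrightarrow> s ''v'' i' = s0 ''v'' i' \<and> s ''pi'' i' = s0 ''pi'' i' \<and> q_val D Y i' = q_val D Y0 i')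
              \<and> first_max (q_val D Y i) a (s ''v'' i) (s ''pi'' i)"])
  fix a s Y
  assume a: "a < nA D" and I: "agree state_vars s s0 \<and>
              (\<forall>i'. i' \<noteq> i \<longrightarrow> s ''v'' i' = s0 ''v'' i' \<and> s ''pi'' i' = s0 ''pi'' i' \<and> q_val D Y i' = q_val D Y0 i')
              \<and> first_max (q_val D Y i) a (s ''v'' i) (s ''pi'' i)"
  let ?s = "store_at ''a'' 0 (real a) s"
  have ag: "agree state_vars ?s s0"
    using I by (simp add: agree_store_at state_vars_def)
  have eqs: "?s ''i'' = s0 ''i''" "?s ''m'' = s0 ''m''" "?s ''u'' = s0 ''u''"
    by (rule agreeD[OF ag]; simp add: state_vars_def action_vars_def)+
  have "holds_mdp D ?s"
    using s0 by (subst holds_mdp_agree[OF ag]) (auto simp: state_vars_def action_vars_def)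
  note step = refines_action_step[where e = e and d = d and b = b and m = m and i = i and a = a and w = w and f = "q_val D Y i",
      OF smp this]
  have "refines (exec smp action_step ?s) (ApxTrans D w b i a e d)
           (\<lambda>s' y. agree action_vars s' ?s \<and>
              (\<forall>i'. i' \<noteq> i \<longrightarrow> s' ''v'' i' = ?s ''v'' i' \<and> s' ''pi'' i' = ?s ''pi'' i')
              \<and> first_max ((q_val D Y i)(a := reward D i a + discount D * y)) (Suc a) (s' ''v'' i) (s' ''pi'' i))
           (m * (c + 30) + 100)"
    by (rule step) (use i a m w supp m_eq I in \<open>auto simp: eqs store_at_same store_at_other\<close>)
  thus "refines (exec smp action_step ?s) (map_pmf (\<lambda>y. Y((i, a) := y)) (q (i, a)))
          (\<lambda>s Y. agree state_vars s s0 \<and>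
              (\<forall>i'. i' \<noteq> i \<longrightarrow> s ''v'' i' = s0 ''v'' i' \<and> s ''pi'' i' = s0 ''pi'' i' \<and> q_val D Y i' = q_val D Y0 i')
              \<and> first_max (q_val D Y i) (Suc a) (s ''v'' i) (s ''pi'' i))
          (m * (c + 30) + 100)"
    unfolding q_def prod.case
  proof (intro refines_map_pmf, elim refines_weaken)
    fix s' y assume "agree action_vars s' ?s \<and>
              (\<forall>i'. i' \<noteq> i \<longrightarrow> s' ''v'' i' = ?s ''v'' i' \<and> s' ''pi'' i' = ?s ''pi'' i')
              \<and> first_max ((q_val D Y i)(a := reward D i a + discount D * y)) (Suc a) (s' ''v'' i) (s' ''pi'' i)"
    moreover have "q_val D (Y((i, a) := y)) i' = q_val D Y i'" if "i' \<noteq> i" for i'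
      using that by (auto simp: q_val_def)
    ultimately show "agree state_vars s' s0 \<and>
              (\<forall>i'. i' \<noteq> i \<longrightarrow> s' ''v'' i' = s0 ''v'' i' \<and> s' ''pi'' i' = s0 ''pi'' i' \<and> q_val D (Y((i, a) := y)) i' = q_val D Y0 i')
              \<and> first_max (q_val D (Y((i, a) := y)) i) (Suc a) (s' ''v'' i) (s' ''pi'' i)"
      using I agree_trans[OF _ ag, of action_vars s' state_vars]
      by (auto simp: q_val_fun_upd store_at_other state_vars_def)
  qed simp
qed (use s0 in \<open>auto simp: nval_def holds_mdp_def agree_refl first_max_def algebra_simps\<close>)

section \<open>The sup norm of the current iterate\<close>

text \<open>The copy \<open>u\<close> is needed because the sweep over the states overwrites
  \<open>v\<close> while sampling still refers to the old iterate. The absolute value is obtained by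
  comparing with both signs.\<close>

definition norm_step :: cmd where
  "norm_step = Seq (Assign ''u'' (scalar ''i'') (Read ''v'' (scalar ''i'')))
     (Seq (IfLe (scalar ''norm'') (Read ''v'' (scalar ''i''))
            (Assign ''norm'' (Const 0) (Read ''v'' (scalar ''i''))) Skip)
          (IfLe (scalar ''norm'') (Sub (Const 0) (Read ''v'' (scalar ''i'')))
            (Assign ''norm'' (Const 0) (Sub (Const 0) (Read ''v'' (scalar ''i'')))) Skip))"

lemma refines_norm_step:
  assumes "s ''i'' 0 = real i"
  shows "refines (exec smp norm_step s) (return_pmf ())
           (\<lambda>s' _. s' = store_at ''norm'' 0 (max (s ''norm'' 0) \<bar>s ''v'' i\<bar>) (store_at ''u'' i (s ''v'' i) s)) 60"
proof -
  \<comment> \<open>A \<open>Skip\<close> branch is read as an assignment of the present value, so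
    that both branches end in a store of the same form.\<close>
  have idem: "store_at ''norm'' 0 y s = s" if "s ''norm'' 0 = y" for s y
    using that by (auto simp: store_at_def)
  have over: "store_at x k y (store_at x k y' s) = store_at x k y s" for x k y y' s
    by (simp add: store_at_def)
  let ?s1 = "store_at ''u'' i (s ''v'' i) s"
  let ?s2 = "store_at ''norm'' 0 (max (s ''norm'' 0) (s ''v'' i)) ?s1"
  have if1: "refines (exec smp (IfLe (scalar ''norm'') (Read ''v'' (scalar ''i''))
            (Assign ''norm'' (Const 0) (Read ''v'' (scalar ''i''))) Skip) ?s1) (return_pmf ())
            (\<lambda>s' _. s' = ?s2) 20"
    by (rule refines_IfLe[where ?B1.0 = 10]; (rule refines_Assign refines_Skip)?)
       (use assms in \<open>auto simp: nval_def store_at_same store_at_other max_def intro!: idem[symmetric]\<close>)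
  have if2: "refines (exec smp (IfLe (scalar ''norm'') (Sub (Const 0) (Read ''v'' (scalar ''i'')))
            (Assign ''norm'' (Const 0) (Sub (Const 0) (Read ''v'' (scalar ''i'')))) Skip) ?s2) (return_pmf ())
            (\<lambda>s' _. s' = store_at ''norm'' 0 (max (s ''norm'' 0) \<bar>s ''v'' i\<bar>) ?s1) 25"
    by (rule refines_IfLe[where ?B1.0 = 10]; (rule refines_Assign refines_Skip)?)
       (use assms in \<open>auto simp: nval_def store_at_same store_at_other over max_def abs_if\<close>)
  have "refines (exec smp (Seq (IfLe (scalar ''norm'') (Read ''v'' (scalar ''i''))
            (Assign ''norm'' (Const 0) (Read ''v'' (scalar ''i''))) Skip)
          (IfLe (scalar ''norm'') (Sub (Const 0) (Read ''v'' (scalar ''i'')))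
            (Assign ''norm'' (Const 0) (Sub (Const 0) (Read ''v'' (scalar ''i'')))) Skip)) ?s1) (return_pmf ())
            (\<lambda>s' _. s' = store_at ''norm'' 0 (max (s ''norm'' 0) \<bar>s ''v'' i\<bar>) ?s1) 45"
    by (rule refines_Seq_return[OF if1]) (use if2 in auto)
  thus ?thesis
    unfolding norm_step_def
    by (intro refines_Seq_Assign[where ?B1.0 = 45]) (use assms in \<open>simp_all add: nval_def\<close>)
qed

definition norm_vars :: "string set" where
  "norm_vars = {''i'', ''u'', ''norm''}"

lemma refines_norm_loop:
  assumes nS: "s0 ''nS'' 0 = real (nS D)" "0 < nS D" and norm: "s0 ''norm'' 0 = 0"
  shows "refines (exec smp (For ''i'' (scalar ''nS'') norm_step) s0) (return_pmf ())
           (\<lambda>s _. agree norm_vars s s0 \<and> (\<forall>i<nS D. s ''u'' i = s0 ''v'' i) \<and>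
                 s ''norm'' 0 = sup_norm D (s0 ''v''))
           (nS D * 70 + 10)"
proof -
  \<comment> \<open>The inserted 0 makes the maximum defined before the first state. It is dropped
    at the end, since absolute values are nonnegative and S is nonempty.\<close>
  define I where "I = (\<lambda>k s (_ :: unit). agree norm_vars s s0 \<and> (\<forall>i<k. s ''u'' i = s0 ''v'' i) \<and>
                 s ''norm'' 0 = Max (insert 0 ((\<lambda>i. \<bar>s0 ''v'' i\<bar>) ` {..<k})))"
  have "refines (exec smp (For ''i'' (scalar ''nS'') norm_step) s0) (return_pmf ()) (I (nS D)) (nS D * 70 + 10)"
  proof (rule refines_For[where P = "\<lambda>_. return_pmf ()" and F = "\<lambda>_ _. return_pmf ()" and B = 60])
    fix k s y assume I: "I k s y"
    let ?s = "store_at ''i'' 0 (real k) s"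
    have ag: "agree norm_vars s s0" using I by (simp add: I_def)
    have v: "s ''v'' = s0 ''v''" by (rule agreeD[OF ag]) (simp add: norm_vars_def)
    have "refines (exec smp norm_step ?s) (return_pmf ())
           (\<lambda>s' _. s' = store_at ''norm'' 0 (max (?s ''norm'' 0) \<bar>?s ''v'' k\<bar>) (store_at ''u'' k (?s ''v'' k) ?s)) 60"
      by (rule refines_norm_step) (simp add: store_at_same)
    thus "refines (exec smp norm_step ?s) (return_pmf ()) (I (Suc k)) 60"
    proof (elim refines_weaken)
      fix s' assume s': "s' = store_at ''norm'' 0 (max (?s ''norm'' 0) \<bar>?s ''v'' k\<bar>) (store_at ''u'' k (?s ''v'' k) ?s)"
      have "agree norm_vars s' s0" using ag by (simp add: s' agree_store_at norm_vars_def)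
      moreover have "\<forall>i<Suc k. s' ''u'' i = s0 ''v'' i"
        using I v by (auto simp: s' I_def store_at_same store_at_other)
      moreover have "s' ''norm'' 0 = max \<bar>s0 ''v'' k\<bar> (Max (insert 0 ((\<lambda>i. \<bar>s0 ''v'' i\<bar>) ` {..<k})))"
        using I v by (simp add: s' I_def store_at_same store_at_other max.commute)
      hence "s' ''norm'' 0 = Max (insert 0 ((\<lambda>i. \<bar>s0 ''v'' i\<bar>) ` {..<Suc k}))"
        by (simp add: lessThan_Suc insert_commute[of 0])
      ultimately show "I (Suc k) s' y" for y by (simp add: I_def)
    qed simp
  qed (use nS norm in \<open>auto simp: I_def nval_def agree_refl bind_return_pmf\<close>)
  thus ?thesis
  proof (rule refines_weaken)
    have "Max (insert 0 ((\<lambda>i. \<bar>s0 ''v'' i\<bar>) ` {..<nS D})) = sup_norm D (s0 ''v'')"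
    proof -
      have "0 \<le> sup_norm D (s0 ''v'')"
        unfolding sup_norm_def using nS by (subst Max_ge_iff) auto
      thus ?thesis using nS by (subst Max_insert) (auto simp: sup_norm_def lessThan_empty_iff)
    qed
    thus "agree norm_vars s s0 \<and> (\<forall>i<nS D. s ''u'' i = s0 ''v'' i) \<and> s ''norm'' 0 = sup_norm D (s0 ''v'')"
      if "I (nS D) s y" for s y using that by (simp add: I_def)
  qed simp
qed

section \<open>One round of the algorithm\<close>

definition m_exp :: aexp where
  "m_exp = Ceil (Mul (Div (Mul (Const 2) (Mul (scalar ''norm'') (scalar ''norm''))) (Mul (scalar ''e'') (scalar ''e'')))
                     (Ln (Div (Const 2) (scalar ''d''))))"

definition round_cmd :: cmd where
  "round_cmd = Seq (Assign ''norm'' (Const 0) (Const 0)) (Seq (For ''i'' (scalar ''nS'') norm_step)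
     (Seq (Assign ''m'' (Const 0) m_exp)
       (For ''i'' (scalar ''nS'') (For ''a'' (scalar ''nA'') action_step))))"

definition round_vars :: "string set" where
  "round_vars = {''norm'', ''m''} \<union> norm_vars \<union> state_vars"

definition represents :: "dmdp \<Rightarrow> store \<Rightarrow> (nat \<Rightarrow> real) \<times> (nat \<Rightarrow> nat) \<Rightarrow> bool" where
  "represents D s = (\<lambda>(v, \<pi>). \<forall>i<nS D. s ''v'' i = v i \<and> s ''pi'' i = real (\<pi> i))"

text \<open>\<open>m\<close> is an upper bound on the sample count and not the count itself, so that
  all rounds can share one time bound.\<close>

definition round_time :: "dmdp \<Rightarrow> nat \<Rightarrow> nat \<Rightarrow> nat" where
  "round_time D c m = nS D * (nA D * (m * (c + 30) + 110) + 20) + 10 + nS D * 70 + 100"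

text \<open>For \<open>v0 = 0\<close> the reference values vanish and \<open>u - v0\<close> is
  \<open>u\<close>, so the copied iterate is what gets sampled. The count \<open>m'\<close> of the
  round follows the norm of \<open>u\<close>; the time is charged at the bound
  \<open>m\<close>.\<close>

lemma refines_round:
  assumes D: "is_dmdp D M" and smp: "is_sampler D (real c) smp" and s0: "holds_mdp D s0"
    and rep: "\<And>i. i < nS D \<Longrightarrow> s0 ''v'' i = u i"
    and e: "s0 ''e'' 0 = e" and d: "s0 ''d'' 0 = \<delta> / real (nS D * nA D)" "0 < \<delta>" "\<delta> < 1"
    and m: "2 * (sup_norm D u)\<^sup>2 / e\<^sup>2 * ln (2 / (\<delta> / real (nS D * nA D))) \<le> real m"
  shows "refines (exec smp round_cmd s0) (ApxVal Min D u (\<lambda>_. 0) (expected_val D (\<lambda>_. 0)) e \<delta>)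
           (\<lambda>s y. agree round_vars s s0 \<and> represents D s y) (round_time D c m)"
proof -
  have nS: "0 < nS D" "0 < nA D" using D by (auto simp: is_dmdp_def)
  define d' where "d' = \<delta> / real (nS D * nA D)"
  define b where "b = sup_norm D u"
  define x where "x = 2 * b\<^sup>2 / e\<^sup>2 * ln (2 / d')"
  define m' where "m' = nat \<lceil>x\<rceil>"
  define q where "q = (\<lambda>(i, a). ApxTrans D u b i a e d')"
  define R where "R = (\<lambda>s y. agree round_vars s s0 \<and> represents D s y)"
  have "1 \<le> real (nS D * nA D)" using nS by (simp add: Suc_le_eq flip: of_nat_mult)
  hence "d' \<le> \<delta> / 1" unfolding d'_def using d by (intro divide_left_mono) auto
  moreover have "0 < d'" using d nS by (simp add: d'_def)
  ultimately have "1 < 2 / d'" using d by (simp add: field_simps)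
  \<comment> \<open>Nonnegativity makes the ceiling computed in a real cell equal to the natural
    number \<open>m'\<close>.\<close>
  hence x0: "0 \<le> x" by (simp add: x_def)
  have m': "m' \<le> m" using m by (simp add: m'_def x_def b_def d'_def nat_le_iff ceiling_le_iff)
  have sup: "sup_norm D (s0 ''v'') = b"
    unfolding b_def sup_norm_def using rep by (auto intro!: arg_cong[of _ _ Max] image_cong)
  define s1 where "s1 = store_at ''norm'' 0 0 s0"
  have ag1: "agree round_vars s1 s0" by (simp add: s1_def agree_store_at agree_refl round_vars_def)
  have apx: "ApxVal Min D u (\<lambda>_. 0) (expected_val D (\<lambda>_. 0)) e \<delta> =
     map_pmf (\<lambda>Y. (\<lambda>i. if i < nS D then Max (q_val D Y i ` {..<nA D}) else 0,
           \<lambda>i. if i < nS D then Min {a. is_arg_max (q_val D Y i) (\<lambda>a. a < nA D) a} else 0))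
       (Pi_pmf ({..<nS D} \<times> {..<nA D}) 0 q)"
  proof -
    have "expected_val D (\<lambda>_. 0) = (\<lambda>_ _. 0)" by (simp add: expected_val_def fun_eq_iff)
    thus ?thesis
      by (simp only: ApxVal_def Let_def map_pmf_def q_def b_def d'_def q_val_def[abs_def] diff_zero add_0)
  qed
  have rows: "refines (exec smp (For ''i'' (scalar ''nS'') (For ''a'' (scalar ''nA'') action_step)) s)
      (ApxVal Min D u (\<lambda>_. 0) (expected_val D (\<lambda>_. 0)) e \<delta>) R
      (nS D * (nA D * (m * (c + 30) + 110) + 20) + 10)"
    if ags: "agree round_vars s s0" and ms: "s ''m'' 0 = real m'" and us: "\<And>i. i < nS D \<Longrightarrow> s ''u'' i = u i" for s
  proof -
    have nSs: "s ''nS'' = s0 ''nS''"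
      by (rule agreeD[OF ags]) (simp add: round_vars_def norm_vars_def state_vars_def action_vars_def)
    define I where "I = (\<lambda>k t Y. agree (insert ''i'' state_vars) t s \<and>
       (\<forall>i<k. first_max (q_val D Y i) (nA D) (t ''v'' i) (t ''pi'' i)))"
    have "refines (exec smp (For ''i'' (scalar ''nS'') (For ''a'' (scalar ''nA'') action_step)) s)
         (Pi_pmf ({..<nS D} \<times> {..<nA D}) 0 q) (I (nS D)) (nS D * (nA D * (m * (c + 30) + 110) + 20) + 10)"
    \<comment> \<open>The product over the empty index set is the constant table 0; every state adds
      one row to it.\<close>
    proof (rule refines_For[where P = "\<lambda>k. Pi_pmf ({..<k} \<times> {..<nA D}) 0 q" and ?y0.0 = "\<lambda>_. 0" and
            F = "\<lambda>k. fill_row q k (nA D)" and B = "nA D * (m * (c + 30) + 110) + 10"])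
      fix i t Y assume i: "i < nS D" and I: "I i t Y"
      let ?t = "store_at ''i'' 0 (real i) t"
      have ag: "agree (insert ''i'' state_vars) ?t s" using I by (simp add: I_def agree_store_at)
      have ag0: "agree round_vars ?t s0"
        by (rule agree_trans[OF ag ags]) (auto simp: round_vars_def norm_vars_def)
      have eqs: "?t ''m'' = s ''m''" "?t ''u'' = s ''u''"
        by (rule agreeD[OF ag]; simp add: state_vars_def action_vars_def)+
      have hold: "holds_mdp D ?t"
        using s0 by (subst holds_mdp_agree[OF ag0]) (auto simp: round_vars_def norm_vars_def state_vars_def action_vars_def)
      have "refines (exec smp (For ''a'' (scalar ''nA'') action_step) ?t) (fill_row q i (nA D) Y)
           (\<lambda>t' Y'. agree state_vars t' ?t \<and>
              (\<forall>i'. i' \<noteq> i \<longrightarrow> t' ''v'' i' = ?t ''v'' i' \<and> t' ''pi'' i' = ?t ''pi'' i' \<and> q_val D Y' i' = q_val D Y i')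
              \<and> first_max (q_val D Y' i) (nA D) (t' ''v'' i) (t' ''pi'' i))
           (nA D * (m' * (c + 30) + 110) + 10)"
        unfolding q_def
        by (rule refines_state_step[OF smp hold])
           (use D i ms us in \<open>auto simp: eqs store_at_same is_dmdp_def m'_def x_def\<close>)
      thus "refines (exec smp (For ''a'' (scalar ''nA'') action_step) ?t) (fill_row q i (nA D) Y) (I (Suc i))
              (nA D * (m * (c + 30) + 110) + 10)"
      proof (rule refines_weaken)
        fix t' Y' assume A: "agree state_vars t' ?t \<and>
              (\<forall>i'. i' \<noteq> i \<longrightarrow> t' ''v'' i' = ?t ''v'' i' \<and> t' ''pi'' i' = ?t ''pi'' i' \<and> q_val D Y' i' = q_val D Y i')
              \<and> first_max (q_val D Y' i) (nA D) (t' ''v'' i) (t' ''pi'' i)"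
        hence "agree (insert ''i'' state_vars) t' s" by (intro agree_trans[OF _ ag]) auto
        thus "I (Suc i) t' Y'" using A I by (auto simp: I_def less_Suc_eq store_at_other)
      qed (use m' in \<open>auto intro!: mult_le_mono add_le_mono\<close>)
    next
      fix k
      show "Pi_pmf ({..<Suc k} \<times> {..<nA D}) 0 q = Pi_pmf ({..<k} \<times> {..<nA D}) 0 q \<bind> fill_row q k (nA D)"
        by (subst bind_fill_row) (auto simp: lessThan_Suc intro!: arg_cong[of _ _ "\<lambda>A. Pi_pmf A 0 q"])
    qed (use s0 in \<open>auto simp: I_def agree_refl nval_def nSs holds_mdp_def algebra_simps\<close>)
    thus ?thesis
      unfolding apx
    proof (intro refines_map_pmf, elim refines_weaken)
      fix t Y assume I: "I (nS D) t Y"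
      have "agree round_vars t s0"
        by (rule agree_trans[OF conjunct1[OF I[unfolded I_def]] ags]) (auto simp: round_vars_def norm_vars_def)
      moreover have "first_max (q_val D Y i) (nA D) (t ''v'' i) (t ''pi'' i)" if "i < nS D" for i
        using I that by (simp add: I_def)
      ultimately show "R t (\<lambda>i. if i < nS D then Max (q_val D Y i ` {..<nA D}) else 0,
           \<lambda>i. if i < nS D then Min {a. is_arg_max (q_val D Y i) (\<lambda>a. a < nA D) a} else 0)"
        using first_max_imp[OF _ nS(2)] unfolding R_def represents_def by force
    qed simp
  qed
  have "refines (exec smp (Seq (For ''i'' (scalar ''nS'') norm_step)
     (Seq (Assign ''m'' (Const 0) m_exp)
       (For ''i'' (scalar ''nS'') (For ''a'' (scalar ''nA'') action_step)))) s1)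
    (ApxVal Min D u (\<lambda>_. 0) (expected_val D (\<lambda>_. 0)) e \<delta>) R (round_time D c m - 10)"
  proof (rule refines_Seq_return)
    show "refines (exec smp (For ''i'' (scalar ''nS'') norm_step) s1) (return_pmf ())
           (\<lambda>s _. agree norm_vars s s1 \<and> (\<forall>i<nS D. s ''u'' i = s1 ''v'' i) \<and> s ''norm'' 0 = sup_norm D (s1 ''v''))
           (nS D * 70 + 10)"
      using s0 nS by (intro refines_norm_loop) (auto simp: s1_def store_at_same store_at_other holds_mdp_def)
  next
    fix s assume A: "agree norm_vars s s1 \<and> (\<forall>i<nS D. s ''u'' i = s1 ''v'' i) \<and> s ''norm'' 0 = sup_norm D (s1 ''v'')"
    have v: "s1 ''v'' = s0 ''v''" by (simp add: s1_def store_at_other)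
    have norm: "s ''norm'' 0 = b" using A sup v by simp
    have ag: "agree round_vars s s0"
      by (rule agree_trans[OF conjunct1[OF A] ag1]) (auto simp: round_vars_def)
    have [simp]: "s ''e'' = s0 ''e''" "s ''d'' = s0 ''d''"
      by (rule agreeD[OF ag]; simp add: round_vars_def norm_vars_def state_vars_def action_vars_def)+
    have "aval m_exp s = of_int \<lceil>x\<rceil>"
      using e d norm by (simp add: m_exp_def x_def d'_def power2_eq_square)
    also have "\<dots> = real m'" using x0 by (simp add: m'_def)
    finally have aval: "aval m_exp s = real m'" .
    show "refines (exec smp (Seq (Assign ''m'' (Const 0) m_exp)
       (For ''i'' (scalar ''nS'') (For ''a'' (scalar ''nA'') action_step))) s)
        (ApxVal Min D u (\<lambda>_. 0) (expected_val D (\<lambda>_. 0)) e \<delta>) R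
        (nS D * (nA D * (m * (c + 30) + 110) + 20) + 10 + 50)"
    proof (rule refines_Seq_Assign[OF rows])
      show "agree round_vars (store_at ''m'' (nval (Const 0) s) (aval m_exp s) s) s0"
        using ag by (simp add: agree_store_at round_vars_def)
      show "store_at ''m'' (nval (Const 0) s) (aval m_exp s) s ''m'' 0 = real m'"
        by (simp add: aval nval_def store_at_same)
      show "store_at ''m'' (nval (Const 0) s) (aval m_exp s) s ''u'' i = u i" if "i < nS D" for i
        using A v rep that by (simp add: store_at_other)
    qed (simp add: m_exp_def)
  qed (simp add: round_time_def)
  hence "refines (exec smp round_cmd s0) (ApxVal Min D u (\<lambda>_. 0) (expected_val D (\<lambda>_. 0)) e \<delta>) R (round_time D c m)"
    unfolding round_cmd_def
    by (intro refines_Seq_Assign[where ?B1.0 = "round_time D c m - 10"])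
       (auto simp: s1_def nval_def round_time_def)
  thus ?thesis by (simp add: R_def)
qed

section \<open>Bounds on the iterates that hold for every outcome\<close>

text \<open>A mean of values bounded by \<open>K\<close> is bounded by \<open>K\<close>; the empty
  mean is 0, which is where \<open>0 \<le> K\<close> enters.\<close>

lemma abs_ApxTrans_le:
  assumes y: "y \<in> set_pmf (ApxTrans D u b i a e d)" and "set_pmf (trans_pmf D i a) \<subseteq> {..<nS D}"
    and K: "\<And>j. j < nS D \<Longrightarrow> \<bar>u j\<bar> \<le> K" "0 \<le> K"
  shows "\<bar>y\<bar> \<le> K"
proof -
  from y obtain js m where js: "set js \<subseteq> {..<nS D}" "length js = m" "y = (\<Sum>j\<leftarrow>js. u j) / real m"
    using assms(2) unfolding ApxTrans_def Let_def set_map_pmf set_replicate_pmf by blast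
  have "\<bar>\<Sum>j\<leftarrow>js. u j\<bar> \<le> (\<Sum>j\<leftarrow>js. \<bar>u j\<bar>)"
    using sum_list_abs[of "map u js"] by (simp add: o_def)
  also have "\<dots> \<le> (\<Sum>j\<leftarrow>js. K)" using js K by (intro sum_list_mono) auto
  also have "\<dots> = real m * K" using js by (simp add: sum_list_triv)
  finally have "\<bar>\<Sum>j\<leftarrow>js. u j\<bar> \<le> real m * K" .
  thus ?thesis using K by (cases "m = 0") (simp_all add: js(3) abs_divide field_simps)
qed

lemma abs_ApxVal_le:
  assumes D: "is_dmdp D M"
    and v: "(v, \<pi>) \<in> set_pmf (ApxVal pick D u (\<lambda>_. 0) (expected_val D (\<lambda>_. 0)) e d)"
    and K: "\<And>j. j < nS D \<Longrightarrow> \<bar>u j\<bar> \<le> K" "0 \<le> K" and i: "i < nS D"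
  shows "\<bar>v i\<bar> \<le> M + discount D * K"
proof -
  define d' where "d' = d / real (nS D * nA D)"
  have ev0: "expected_val D (\<lambda>_. 0) = (\<lambda>_ _. 0)" by (simp add: expected_val_def fun_eq_iff)
  from v obtain Y where
    Y: "Y \<in> set_pmf (Pi_pmf ({..<nS D} \<times> {..<nA D}) 0 (\<lambda>(i, a). ApxTrans D u (sup_norm D u) i a e d'))"
    and vi: "v i = Max ((\<lambda>a. reward D i a + discount D * Y (i, a)) ` {..<nA D})"
    using i by (auto simp: ApxVal_def Let_def d'_def ev0)
  have "v i \<in> (\<lambda>a. reward D i a + discount D * Y (i, a)) ` {..<nA D}"
    unfolding vi using D by (intro Max_in) (auto simp: is_dmdp_def)
  then obtain a where a: "a < nA D" "v i = reward D i a + discount D * Y (i, a)" by auto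
  have "Y (i, a) \<in> set_pmf (ApxTrans D u (sup_norm D u) i a e d')"
    using Y i a by (auto simp: set_Pi_pmf PiE_dflt_def)
  hence "\<bar>Y (i, a)\<bar> \<le> K" by (rule abs_ApxTrans_le) (use D i a K in \<open>auto simp: is_dmdp_def\<close>)
  hence "\<bar>discount D * Y (i, a)\<bar> \<le> discount D * K" using D by (simp add: abs_mult is_dmdp_def)
  moreover have "reward D i a \<in> {-M..M}" using D i a unfolding is_dmdp_def by blast
  hence "\<bar>reward D i a\<bar> \<le> M" by auto
  ultimately show ?thesis unfolding a by linarith
qed

text \<open>M/(1-\<gamma>) is the fixed point of the map sending K to M + \<gamma> K. The bound
  limits the sample counts even in runs where the estimates are poor.\<close>

lemma abs_RandomizedVI_iter_le:
  assumes D: "is_dmdp D M"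
    and y: "y \<in> set_pmf (RandomizedVI_iter pick D (\<lambda>_. 0) (expected_val D (\<lambda>_. 0)) e d l)" and "i < nS D"
  shows "\<bar>fst y i\<bar> \<le> M / (1 - discount D)"
  using y \<open>i < nS D\<close>
proof (induction l arbitrary: y i)
  case 0
  then show ?case using D by (simp add: is_dmdp_def)
next
  case (Suc l)
  from Suc.prems obtain z where z: "z \<in> set_pmf (RandomizedVI_iter pick D (\<lambda>_. 0) (expected_val D (\<lambda>_. 0)) e d l)"
     "(fst y, snd y) \<in> set_pmf (ApxVal pick D (fst z) (\<lambda>_. 0) (expected_val D (\<lambda>_. 0)) e d)"
    by (auto simp: case_prod_beta')
  have "\<bar>fst y i\<bar> \<le> M + discount D * (M / (1 - discount D))"
    using D by (intro abs_ApxVal_le[OF D z(2)] Suc.IH[OF z(1)] Suc.prems) (auto simp: is_dmdp_def)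
  also have "\<dots> = M / (1 - discount D)" using D by (simp add: is_dmdp_def field_simps)
  finally show ?case .
qed

section \<open>The complete program\<close>

text \<open>
  Since \<open>v0 = 0\<close>, the exact values \<open>x\<close> vanish.  The program never computes them, which would take
  time of order \<open>nS\<^sup>2 nA\<close>, and it does not read the array \<open>p\<close>.
\<close>

definition L_exp :: aexp where
  "L_exp = Ceil (Mul (Div (Const 1) (Sub (Const 1) (scalar ''gamma'')))
     (Ln (Div (Mul (Const 2) (scalar ''M''))
       (Mul (Mul (Sub (Const 1) (scalar ''gamma'')) (Sub (Const 1) (scalar ''gamma''))) (scalar ''eps'')))))"

definition e_exp :: aexp where
  "e_exp = Div (Mul (Sub (Const 1) (scalar ''gamma'')) (scalar ''eps'')) (Mul (Const 4) (scalar ''gamma''))"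

text \<open>Confidence of a single \<open>ApxTrans\<close> call: \<delta> is split over the rounds
  by \<open>RandomizedVI\<close> and over the state-action pairs by \<open>ApxVal\<close>.\<close>

definition d_exp :: aexp where
  "d_exp = Div (Div (scalar ''delta'') (scalar ''L'')) (Mul (scalar ''nS'') (scalar ''nA''))"

definition vi_prog :: cmd where
  "vi_prog = Seq (Assign ''L'' (Const 0) L_exp) (Seq (Assign ''e'' (Const 0) e_exp)
     (Seq (Assign ''d'' (Const 0) d_exp) (For ''l'' (scalar ''L'') round_cmd)))"

text \<open>\<open>m\<close> is the sample count belonging to the largest possible norm
  M/(1-\<gamma>) of an iterate; it bounds the count of every round.\<close>

lemma refines_vi_prog:
  fixes D M \<epsilon> \<delta> c
  defines "g \<equiv> discount D"
  defines "L \<equiv> nat \<lceil>1 / (1 - g) * ln (2 * M / ((1 - g)\<^sup>2 * \<epsilon>))\<rceil>"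
  defines "e \<equiv> (1 - g) * \<epsilon> / (4 * g)"
  defines "m \<equiv> nat \<lceil>2 * (M / (1 - g))\<^sup>2 / e\<^sup>2 * ln (2 / (\<delta> / real L / real (nS D * nA D)))\<rceil>"
  assumes D: "is_dmdp D M" and \<epsilon>: "0 < \<epsilon>" "\<epsilon> < M / (1 - g)" and \<delta>: "0 < \<delta>" "\<delta> < 1"
    and smp: "is_sampler D (real c) smp"
  shows "refines (exec smp vi_prog (input_store D M \<epsilon> \<delta>)) (RandomizedVI Min D (\<lambda>_. 0) L e \<delta>)
           (represents D) (L * (1 + round_time D c m) + 200)"
proof -
  have g: "0 < g" "g < 1" and M: "0 < M" and nS: "0 < nS D" "0 < nA D"
    using D by (auto simp: g_def is_dmdp_def)
  have L: "1 \<le> L" and ln_pos: "0 < ln (2 * M / ((1 - g)\<^sup>2 * \<epsilon>))"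
    unfolding L_def using iteration_count[OF M g \<epsilon>] by auto
  have "0 \<le> 1 / (1 - g) * ln (2 * M / ((1 - g)\<^sup>2 * \<epsilon>))" using g ln_pos by simp
  hence L_real: "of_int \<lceil>1 / (1 - g) * ln (2 * M / ((1 - g)\<^sup>2 * \<epsilon>))\<rceil> = real L"
    unfolding L_def by (subst of_nat_nat) auto
  have \<delta>L: "0 < \<delta> / real L" "\<delta> / real L < 1"
  proof -
    have "\<delta> / real L \<le> \<delta> / 1" using L \<delta> by (intro divide_left_mono) auto
    thus "\<delta> / real L < 1" using \<delta> by simp
  qed (use L \<delta> in simp)
  define N where "N = nS D * nA D"
  have N: "1 \<le> real N" using nS by (simp add: N_def Suc_le_eq flip: of_nat_mult)
  have "\<delta> / real L / real N \<le> \<delta> / real L / 1" using \<delta>L N by (intro divide_left_mono) auto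
  moreover have "0 < \<delta> / real L / real N" using N by (intro divide_pos_pos[OF \<delta>L(1)]) linarith
  ultimately have small: "\<delta> / real L / real N < 1" "0 < \<delta> / real L / real N" using \<delta>L by linarith+
  \<comment> \<open>The logarithm has to be nonnegative for the sample count to be monotone in the
    norm.\<close>
  hence ln0: "0 \<le> ln (2 / (\<delta> / real L / real N))"
    by (intro ln_ge_zero, subst pos_le_divide_eq) linarith+
  let ?s0 = "input_store D M \<epsilon> \<delta>"
  let ?s1 = "store_at ''L'' 0 (real L) ?s0"
  let ?s2 = "store_at ''e'' 0 e ?s1"
  let ?s3 = "store_at ''d'' 0 (\<delta> / real L / real N) ?s2"
  have in_store: "?s0 ''nS'' 0 = real (nS D)" "?s0 ''nA'' 0 = real (nA D)" "?s0 ''gamma'' 0 = g"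
     "?s0 ''M'' 0 = M" "?s0 ''eps'' 0 = \<epsilon>" "?s0 ''delta'' 0 = \<delta>" "?s0 ''v'' = (\<lambda>_. 0)" "?s0 ''pi'' = (\<lambda>_. 0)"
    by (simp_all add: input_store_def g_def)
  have in_r: "?s0 ''r'' (i * nA D + a) = reward D i a" if "i < nS D" "a < nA D" for i a
  proof -
    have "i * nA D + a < Suc i * nA D" using that by simp
    also have "\<dots> \<le> nS D * nA D" using that by (intro mult_le_mono1) auto
    finally show ?thesis using that by (simp add: input_store_def)
  qed
  have holds: "holds_mdp D ?s3"
    using in_store in_r by (simp add: holds_mdp_def store_at_other g_def)
  have R: "RandomizedVI Min D (\<lambda>_. 0) L e \<delta> =
      RandomizedVI_iter Min D (\<lambda>_. 0) (expected_val D (\<lambda>_. 0)) e (\<delta> / real L) L"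
    by (simp add: RandomizedVI_def)
  define I where "I = (\<lambda>(l :: nat) s y. agree (insert ''l'' round_vars) s ?s3 \<and> represents D s y)"
  have loop: "refines (exec smp (For ''l'' (scalar ''L'') round_cmd) ?s3)
        (RandomizedVI_iter Min D (\<lambda>_. 0) (expected_val D (\<lambda>_. 0)) e (\<delta> / real L) L) (I L)
        (L * (1 + round_time D c m) + 10)"
  proof (rule refines_For[where B = "round_time D c m" and ?y0.0 = "(\<lambda>_. 0, \<lambda>_. 0)" and
         F = "\<lambda>_ (v, _). ApxVal Min D v (\<lambda>_. 0) (expected_val D (\<lambda>_. 0)) e (\<delta> / real L)" and
         P = "RandomizedVI_iter Min D (\<lambda>_. 0) (expected_val D (\<lambda>_. 0)) e (\<delta> / real L)"])
    fix l s y assume I: "I l s y"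
      and y: "y \<in> set_pmf (RandomizedVI_iter Min D (\<lambda>_. 0) (expected_val D (\<lambda>_. 0)) e (\<delta> / real L) l)"
    let ?s = "store_at ''l'' 0 (real l) s"
    have ag: "agree (insert ''l'' round_vars) ?s ?s3" using I by (simp add: I_def agree_store_at)
    have eqs: "?s ''e'' = ?s3 ''e''" "?s ''d'' = ?s3 ''d''"
      by (rule agreeD[OF ag]; simp add: round_vars_def norm_vars_def state_vars_def action_vars_def)+
    have hold: "holds_mdp D ?s"
      using holds by (subst holds_mdp_agree[OF ag]) (auto simp: round_vars_def norm_vars_def state_vars_def action_vars_def)
    have "sup_norm D (fst y) \<le> M / (1 - g)"
      using abs_RandomizedVI_iter_le[OF D y] nS by (simp add: sup_norm_le_iff g_def)
    hence "2 * (sup_norm D (fst y))\<^sup>2 / e\<^sup>2 * ln (2 / (\<delta> / real L / real N)) \<le>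
           2 * (M / (1 - g))\<^sup>2 / e\<^sup>2 * ln (2 / (\<delta> / real L / real N))"
      using sup_norm_nonneg[OF nS(1), of "fst y"] ln0
      by (intro mult_right_mono divide_right_mono mult_left_mono power_mono) auto
    also have "\<dots> \<le> real m" unfolding m_def N_def by linarith
    finally have m_le: "2 * (sup_norm D (fst y))\<^sup>2 / e\<^sup>2 * ln (2 / (\<delta> / real L / real N)) \<le> real m" .
    have "refines (exec smp round_cmd ?s) (ApxVal Min D (fst y) (\<lambda>_. 0) (expected_val D (\<lambda>_. 0)) e (\<delta> / real L))
           (\<lambda>s' y'. agree round_vars s' ?s \<and> represents D s' y') (round_time D c m)"
      using I \<delta>L m_le
      by (intro refines_round[OF D smp hold])
         (auto simp: eqs store_at_same store_at_other I_def represents_def case_prod_beta' N_def)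
    hence "refines (exec smp round_cmd ?s) (ApxVal Min D (fst y) (\<lambda>_. 0) (expected_val D (\<lambda>_. 0)) e (\<delta> / real L))
           (I (Suc l)) (round_time D c m)"
      by (rule refines_weaken) (use agree_trans[OF _ ag, of round_vars _ "insert ''l'' round_vars"] in \<open>auto simp: I_def\<close>)
    thus "refines (exec smp round_cmd ?s)
        ((case y of (v, _) \<Rightarrow> ApxVal Min D v (\<lambda>_. 0) (expected_val D (\<lambda>_. 0)) e (\<delta> / real L)))
           (I (Suc l)) (round_time D c m)"
      by (simp add: case_prod_beta')
  qed (use in_store in \<open>auto simp: I_def agree_refl represents_def nval_def store_at_same store_at_other\<close>)
  have a1: "store_at ''L'' (nval (Const 0) ?s0) (aval L_exp ?s0) ?s0 = ?s1"
    by (simp add: nval_def L_exp_def in_store L_real[symmetric] power2_eq_square)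
  have a2: "store_at ''e'' (nval (Const 0) ?s1) (aval e_exp ?s1) ?s1 = ?s2"
    by (simp add: nval_def e_exp_def store_at_other in_store e_def)
  have a3: "store_at ''d'' (nval (Const 0) ?s2) (aval d_exp ?s2) ?s2 = ?s3"
    by (simp add: nval_def d_exp_def store_at_other store_at_same in_store N_def)
  show ?thesis
    unfolding vi_prog_def R
  proof (rule refines_Seq_Assign[where ?B1.0 = "L * (1 + round_time D c m) + 100"], unfold a1)
    show "refines (exec smp (Seq (Assign ''e'' (Const 0) e_exp)
     (Seq (Assign ''d'' (Const 0) d_exp) (For ''l'' (scalar ''L'') round_cmd))) ?s1)
      (RandomizedVI_iter Min D (\<lambda>_. 0) (expected_val D (\<lambda>_. 0)) e (\<delta> / real L) L)
      (represents D) (L * (1 + round_time D c m) + 100)"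
    proof (rule refines_Seq_Assign[where ?B1.0 = "L * (1 + round_time D c m) + 50"], unfold a2)
      show "refines (exec smp (Seq (Assign ''d'' (Const 0) d_exp) (For ''l'' (scalar ''L'') round_cmd)) ?s2)
        (RandomizedVI_iter Min D (\<lambda>_. 0) (expected_val D (\<lambda>_. 0)) e (\<delta> / real L) L)
        (represents D) (L * (1 + round_time D c m) + 50)"
      proof (rule refines_Seq_Assign[where ?B1.0 = "L * (1 + round_time D c m) + 10"], unfold a3)
        show "refines (exec smp (For ''l'' (scalar ''L'') round_cmd) ?s3)
          (RandomizedVI_iter Min D (\<lambda>_. 0) (expected_val D (\<lambda>_. 0)) e (\<delta> / real L) L)
          (represents D) (L * (1 + round_time D c m) + 10)"
          by (rule refines_weaken[OF loop]) (auto simp: I_def)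
      qed (simp add: d_exp_def)
    qed (simp add: e_exp_def)
  qed (simp add: L_exp_def)
qed

lemma RandomizedVI_iter_outside:
  assumes "y \<in> set_pmf (RandomizedVI_iter pick D (\<lambda>_. 0) x e d l)" "\<not> i < nS D"
  shows "fst y i = 0 \<and> snd y i = 0"
  using assms by (cases l) (auto simp: ApxVal_def Let_def case_prod_beta')

text \<open>On S the store determines the outcome through \<open>output_of\<close>, and outside S
  both are 0. A coupling along a functional relation is an equality of distributions.\<close>

lemma refines_output:
  assumes "refines X (RandomizedVI pick D (\<lambda>_. 0) L e d) (represents D) B"
  shows "map_pmf (\<lambda>(s, t). output_of D s) X = RandomizedVI pick D (\<lambda>_. 0) L e d"
proof -
  have "rel_pmf (\<lambda>x y. output_of D (fst x) = y) X (RandomizedVI pick D (\<lambda>_. 0) L e d)"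
  proof (rule pmf.rel_mono_strong)
    show "rel_pmf (\<lambda>x y. represents D (fst x) y) X (RandomizedVI pick D (\<lambda>_. 0) L e d)"
      using assms by (simp add: refines_def)
  next
    fix x y assume y: "y \<in> set_pmf (RandomizedVI pick D (\<lambda>_. 0) L e d)" and rep: "represents D (fst x) y"
    show "output_of D (fst x) = y"
      unfolding output_of_def using rep RandomizedVI_iter_outside[OF y[unfolded RandomizedVI_def]]
      by (intro prod_eqI) (auto simp: represents_def fun_eq_iff)
  qed
  hence "rel_pmf (=) (map_pmf (\<lambda>x. output_of D (fst x)) X) (RandomizedVI pick D (\<lambda>_. 0) L e d)"
    by (simp add: pmf.rel_map)
  thus ?thesis by (simp add: pmf.rel_eq case_prod_beta')
qed

section \<open>Running time\<close>

text \<open>Everything is measured by \<open>X\<close>, the argument of the logarithm in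
  \<open>param_log\<close>, which dominates each parameter, and by P = ln X \<ge> 1. Logarithms of
  products of parameters become multiples of \<open>P\<close>, and quantities known to be at least 1
  absorb additive constants.\<close>

lemma time_bound:
  fixes D M \<epsilon> \<delta> c
  defines "g \<equiv> discount D"
  defines "L \<equiv> nat \<lceil>1 / (1 - g) * ln (2 * M / ((1 - g)\<^sup>2 * \<epsilon>))\<rceil>"
  defines "e \<equiv> (1 - g) * \<epsilon> / (4 * g)"
  defines "m \<equiv> nat \<lceil>2 * (M / (1 - g))\<^sup>2 / e\<^sup>2 * ln (2 / (\<delta> / real L / real (nS D * nA D)))\<rceil>"
  assumes D: "is_dmdp D M" and \<epsilon>: "0 < \<epsilon>" "\<epsilon> < M / (1 - g)" and \<delta>: "0 < \<delta>" "\<delta> < 1"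
  shows "real (L * (1 + round_time D c m) + 200) \<le>
    1542 * (real c + 541) * (real (nS D) * real (nA D) * M\<^sup>2 / ((1 - g) ^ 5 * \<epsilon>\<^sup>2) * max 1 (ln (1 / \<epsilon>)))
      * param_log D M \<epsilon> \<delta> ^ 2"
proof -
  define S A where "S = real (nS D)" and "A = real (nA D)"
  define h where "h = 1 / (1 - g)"
  \<comment> \<open>At least 1 by the assumption on \<epsilon>; its square carries the factor
    M^2/\<epsilon>^2 of the final bound.\<close>
  define G where "G = M * h / \<epsilon>"
  define X where "X = 2 + S + A + M + h + 1 / \<epsilon> + 1 / \<delta>"
  define P where "P = ln X"
  have g: "0 < g" "g < 1" and M: "0 < M" and SA: "1 \<le> S" "1 \<le> A"
    using D by (auto simp: g_def is_dmdp_def S_def A_def)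
  have h: "1 \<le> h" using g by (simp add: h_def)
  have inv: "0 < 1 / \<epsilon>" "1 \<le> 1 / \<delta>" using \<epsilon> \<delta> by auto
  have X: "5 \<le> X" "S \<le> X" "A \<le> X" "M \<le> X" "h \<le> X" "1 / \<epsilon> \<le> X" "1 / \<delta> \<le> X"
    unfolding X_def using SA M h inv by linarith+
  have P1: "1 \<le> P" unfolding P_def using X exp_le by (subst ln_ge_iff) auto
  have PX: "P \<le> X" unfolding P_def using X ln_le_minus_one[of X] by simp
  have P_eq: "param_log D M \<epsilon> \<delta> = P" by (simp add: param_log_def P_def X_def S_def A_def h_def g_def)
  have "\<epsilon> \<le> M * h" using \<epsilon> by (simp add: h_def)
  hence G1: "1 \<le> G" using \<epsilon> by (simp add: G_def)
  have lnX: "ln (X ^ n) = real n * P" for n using X by (simp add: ln_realpow P_def)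

  have "2 * M / ((1 - g)\<^sup>2 * \<epsilon>) = 2 * M * h * h * (1 / \<epsilon>)"
    using g \<epsilon> by (simp add: h_def field_simps power2_eq_square)
  also have "\<dots> \<le> X * X * X * X * X"
    using X M h inv by (intro mult_mono) auto
  finally have "2 * M / ((1 - g)\<^sup>2 * \<epsilon>) \<le> X ^ 5" by (simp add: eval_nat_numeral mult_ac)
  hence "ln (2 * M / ((1 - g)\<^sup>2 * \<epsilon>)) \<le> ln (X ^ 5)" using M g \<epsilon> X by (subst ln_le_cancel_iff) auto
  hence lnL: "ln (2 * M / ((1 - g)\<^sup>2 * \<epsilon>)) \<le> 5 * P" by (simp only: lnX of_nat_numeral)
  have ln_pos: "0 < ln (2 * M / ((1 - g)\<^sup>2 * \<epsilon>))" and L1: "1 \<le> L"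
    unfolding L_def using iteration_count[OF M g \<epsilon>] by auto
  have hP: "1 \<le> h * P" using mult_mono[OF h P1] h P1 by simp
  have "real L \<le> h * ln (2 * M / ((1 - g)\<^sup>2 * \<epsilon>)) + 1"
  proof -
    have "0 < h * ln (2 * M / ((1 - g)\<^sup>2 * \<epsilon>))" using h ln_pos by simp
    thus ?thesis unfolding L_def h_def by linarith
  qed
  also have "\<dots> \<le> h * (5 * P) + h * P" using lnL h hP by (intro add_mono mult_left_mono) auto
  finally have L: "real L \<le> 6 * h * P" by (simp add: mult_ac)

  have dN: "2 / (\<delta> / real L / real (nS D * nA D)) = 2 * real L * S * A * (1 / \<delta>)"
    using L1 \<delta> by (simp add: S_def A_def)
  have "2 * real L * S * A * (1 / \<delta>) \<le> 2 * (6 * h * P) * S * A * (1 / \<delta>)"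
    using L SA \<delta> by (intro mult_right_mono mult_left_mono) auto
  \<comment> \<open>Eight factors: two for 6, and one for each of 2, \<open>h\<close>,
    \<open>P\<close>, \<open>S\<close>, \<open>A\<close> and 1/\<delta>.\<close>
  also have "\<dots> \<le> X * (X * X * X * X) * X * X * X"
  proof (intro mult_mono)
    have "6 \<le> X * X" using mult_mono[of 5 X 5 X] X by simp
    thus "6 \<le> X * X" .
  qed (use X h P1 SA \<delta> PX in auto)
  finally have "2 / (\<delta> / real L / real (nS D * nA D)) \<le> X ^ 8"
    unfolding dN by (simp add: eval_nat_numeral mult_ac)
  moreover have arg_pos: "0 < 2 / (\<delta> / real L / real (nS D * nA D))"
    using dN L1 SA \<delta> by simp
  ultimately have "ln (2 / (\<delta> / real L / real (nS D * nA D))) \<le> ln (X ^ 8)"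
    using X by (subst ln_le_cancel_iff) auto
  hence lnm: "ln (2 / (\<delta> / real L / real (nS D * nA D))) \<le> 8 * P" by (simp only: lnX of_nat_numeral)

  \<comment> \<open>The constant 32 is 2 times 4^2, with the 4 from the accuracy parameter; g^2
    \<le> 1 is then dropped.\<close>
  have "2 * (M / (1 - g))\<^sup>2 / e\<^sup>2 = 32 * (G\<^sup>2 * h\<^sup>2) * g\<^sup>2"
    using g \<epsilon> by (simp add: e_def G_def h_def field_simps power2_eq_square)
  also have "\<dots> \<le> 32 * (G\<^sup>2 * h\<^sup>2) * 1"
    using g by (intro mult_left_mono) (auto simp: power_le_one)
  finally have pref: "2 * (M / (1 - g))\<^sup>2 / e\<^sup>2 \<le> 32 * (G\<^sup>2 * h\<^sup>2)" by simp
  have Gh: "1 \<le> G\<^sup>2 * h\<^sup>2" using G1 h by (simp add: mult_ge1_I)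
  have "2 * (M / (1 - g))\<^sup>2 / e\<^sup>2 * ln (2 / (\<delta> / real L / real (nS D * nA D)))
        \<le> 2 * (M / (1 - g))\<^sup>2 / e\<^sup>2 * (8 * P)"
    by (intro mult_left_mono lnm) auto
  also have "\<dots> \<le> 32 * (G\<^sup>2 * h\<^sup>2) * (8 * P)" using pref P1 by (intro mult_right_mono) auto
  finally have "2 * (M / (1 - g))\<^sup>2 / e\<^sup>2 * ln (2 / (\<delta> / real L / real (nS D * nA D)))
        \<le> 256 * (G\<^sup>2 * h\<^sup>2 * P)" by simp
  moreover have GhP: "1 \<le> G\<^sup>2 * h\<^sup>2 * P" using mult_mono[OF Gh P1] Gh P1 by simp
  \<comment> \<open>257 is 256 plus 1, the 1 paying for the ceiling.\<close>
  ultimately have m: "real m \<le> 257 * (G\<^sup>2 * h\<^sup>2 * P)"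
    unfolding m_def by linarith
  define m' where "m' = 257 * (G\<^sup>2 * h\<^sup>2 * P)"
  have m'1: "1 \<le> m'" using GhP by (simp add: m'_def)
  have SA1: "1 \<le> S * A" "S \<le> S * A" using SA mult_mono[of 1 S 1 A] by auto
  have "0 \<le> S * A" using SA1 by linarith
  from mult_left_mono[OF m'1 this] have SAm: "S * A \<le> S * A * m'" by simp
  have "real (1 + round_time D c m) = S * A * (real m * (c + 30)) + 110 * (S * A) + 90 * S + 111"
    by (simp add: round_time_def S_def A_def algebra_simps)
  \<comment> \<open>Each lower-order term is inflated to a multiple of S A m'; 341 is 30 + 110 + 90
    + 111.\<close>
  also have "\<dots> \<le> S * A * (m' * (c + 30)) + 110 * (S * A * m') + 90 * (S * A * m') + 111 * (S * A * m')"
  proof -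
    have "S * A * (real m * (c + 30)) \<le> S * A * (m' * (c + 30))"
      using m \<open>0 \<le> S * A\<close> by (intro mult_left_mono mult_right_mono) (auto simp: m'_def)
    with SA1 SAm show ?thesis by linarith
  qed
  also have "\<dots> = S * A * m' * (c + 341)" by (simp add: algebra_simps)
  finally have round: "real (1 + round_time D c m) \<le> S * A * m' * (c + 341)" .
  have big: "1 \<le> 6 * h * P * (S * A * m')"
  proof -
    have "1 \<le> S * A * m'" using SA1 SAm by linarith
    moreover have "1 \<le> 6 * (h * P)" using hP by linarith
    ultimately have "1 * 1 \<le> 6 * (h * P) * (S * A * m')" by (intro mult_mono) auto
    thus ?thesis by (simp add: mult.assoc)
  qed
  have "real (L * (1 + round_time D c m) + 200) = real L * real (1 + round_time D c m) + 200"
    by (simp only: of_nat_add of_nat_mult of_nat_numeral)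
  also have "\<dots> \<le> 6 * h * P * (S * A * m' * (c + 341)) + 200 * (6 * h * P * (S * A * m'))"
  proof (rule add_mono)
    show "real L * real (1 + round_time D c m) \<le> 6 * h * P * (S * A * m' * (c + 341))"
      using L round h P1 by (intro mult_mono) auto
    show "200 \<le> 200 * (6 * h * P * (S * A * m'))" using big by linarith
  qed
  \<comment> \<open>1542 is 6 times 257 and 541 is 341 + 200. One \<open>P\<close> comes from the
    number of rounds, the other from the sample count.\<close>
  also have "\<dots> = 1542 * (real c + 541) * (S * A * (G\<^sup>2 * h ^ 3)) * P ^ 2"
    by (simp add: m'_def algebra_simps power2_eq_square power3_eq_cube)
  also have "S * A * (G\<^sup>2 * h ^ 3) = S * A * M\<^sup>2 / ((1 - g) ^ 5 * \<epsilon>\<^sup>2)"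
    using g \<epsilon> by (simp add: G_def h_def power_divide power_mult_distrib field_simps eval_nat_numeral)
  \<comment> \<open>For \<epsilon> > 1 the logarithm is negative; the maximum keeps the factor at
    least 1.\<close>
  also have "1542 * (real c + 541) * (S * A * M\<^sup>2 / ((1 - g) ^ 5 * \<epsilon>\<^sup>2)) * P ^ 2 \<le>
      1542 * (real c + 541) * (S * A * M\<^sup>2 / ((1 - g) ^ 5 * \<epsilon>\<^sup>2) * max 1 (ln (1 / \<epsilon>))) * P ^ 2"
  proof (intro mult_right_mono mult_left_mono)
    have "0 \<le> S * A * M\<^sup>2 / ((1 - g) ^ 5 * \<epsilon>\<^sup>2)" using SA g by simp
    from mult_left_mono[OF max.cobounded1[of 1 "ln (1 / \<epsilon>)"] this]
    show "S * A * M\<^sup>2 / ((1 - g) ^ 5 * \<epsilon>\<^sup>2) \<le>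
          S * A * M\<^sup>2 / ((1 - g) ^ 5 * \<epsilon>\<^sup>2) * max 1 (ln (1 / \<epsilon>))"
      by (simp only: mult_1_right)
  qed auto
  finally show ?thesis unfolding P_eq S_def A_def .
qed

text \<open>One program serves all instances, and \<open>C\<close> depends on the oracle cost
  \<open>c\<close> alone. Accuracy is claimed for every tie-breaking rule; the program realizes one
  rule with exactly the abstract output distribution, so the accuracy carries over to it.\<close>

theorem theorem4p7:
  shows "\<exists>(prog :: cmd) (tie0 :: nat set \<Rightarrow> nat) (k :: nat).
    tie_breaking tie0 \<and>
    (\<forall>c :: real. \<exists>C :: real. \<forall>(D :: dmdp) (M :: real) (\<epsilon> :: real) (\<delta> :: real).
      is_dmdp D M \<and> 0 < \<epsilon> \<and> \<epsilon> < M / (1 - discount D) \<and> 0 < \<delta> \<and> \<delta> < 1 \<longrightarrow>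
      (let \<gamma> = discount D;
           run = (\<lambda>tie. RandomizedVI tie D (\<lambda>_. 0)
                     (nat \<lceil>1 / (1 - \<gamma>) * ln (2 * M / ((1 - \<gamma>)\<^sup>2 * \<epsilon>))\<rceil>)
                     ((1 - \<gamma>) * \<epsilon> / (4 * \<gamma>)) \<delta>)
       in (\<forall>tie. tie_breaking tie \<longrightarrow>
             measure_pmf.prob (run tie)
               {(v, \<pi>). sup_norm D (\<lambda>i. v i - opt_val D i) \<le> \<epsilon>} \<ge> 1 - \<delta>) \<and>
          (\<forall>smp. is_sampler D c smp \<longrightarrow>
             map_pmf (\<lambda>(s, t). output_of D s) (exec smp prog (input_store D M \<epsilon> \<delta>)) = run tie0 \<and>
             expected_time (exec smp prog (input_store D M \<epsilon> \<delta>))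
               \<le> ennreal (C * (real (nS D) * real (nA D) * M\<^sup>2 / ((1 - \<gamma>) ^ 5 * \<epsilon>\<^sup>2)
                               * max 1 (ln (1 / \<epsilon>)))
                            * param_log D M \<epsilon> \<delta> ^ k))))"
proof (rule exI[of _ vi_prog], rule exI[of _ Min], rule exI[of _ 2], intro conjI allI)
  show "tie_breaking Min" by (simp add: tie_breaking_def)
next
  fix c :: real
  \<comment> \<open>Time bounds of \<open>refines\<close> are natural numbers, so the oracle cost is
    rounded up.\<close>
  define n where "n = nat \<lceil>c\<rceil>"
  show "\<exists>C :: real. \<forall>(D :: dmdp) (M :: real) (\<epsilon> :: real) (\<delta> :: real).
      is_dmdp D M \<and> 0 < \<epsilon> \<and> \<epsilon> < M / (1 - discount D) \<and> 0 < \<delta> \<and> \<delta> < 1 \<longrightarrow>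
      (let \<gamma> = discount D;
           run = (\<lambda>tie. RandomizedVI tie D (\<lambda>_. 0)
                     (nat \<lceil>1 / (1 - \<gamma>) * ln (2 * M / ((1 - \<gamma>)\<^sup>2 * \<epsilon>))\<rceil>)
                     ((1 - \<gamma>) * \<epsilon> / (4 * \<gamma>)) \<delta>)
       in (\<forall>tie. tie_breaking tie \<longrightarrow>
             measure_pmf.prob (run tie)
               {(v, \<pi>). sup_norm D (\<lambda>i. v i - opt_val D i) \<le> \<epsilon>} \<ge> 1 - \<delta>) \<and>
          (\<forall>smp. is_sampler D c smp \<longrightarrow>
             map_pmf (\<lambda>(s, t). output_of D s) (exec smp vi_prog (input_store D M \<epsilon> \<delta>)) = run Min \<and>
             expected_time (exec smp vi_prog (input_store D M \<epsilon> \<delta>))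
               \<le> ennreal (C * (real (nS D) * real (nA D) * M\<^sup>2 / ((1 - \<gamma>) ^ 5 * \<epsilon>\<^sup>2)
                               * max 1 (ln (1 / \<epsilon>)))
                            * param_log D M \<epsilon> \<delta> ^ 2)))"
  proof (intro exI[of _ "1542 * (real n + 541)"] allI impI, unfold Let_def, intro conjI allI impI)
    fix D :: dmdp and M \<epsilon> \<delta> :: real and smp :: "nat \<Rightarrow> nat \<Rightarrow> (nat \<times> nat) pmf"
    assume A: "is_dmdp D M \<and> 0 < \<epsilon> \<and> \<epsilon> < M / (1 - discount D) \<and> 0 < \<delta> \<and> \<delta> < 1"
      and smp: "is_sampler D c smp"
    let ?L = "nat \<lceil>1 / (1 - discount D) * ln (2 * M / ((1 - discount D)\<^sup>2 * \<epsilon>))\<rceil>"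
    let ?e = "(1 - discount D) * \<epsilon> / (4 * discount D)"
    let ?run = "\<lambda>tie. RandomizedVI tie D (\<lambda>_. 0) ?L ?e \<delta>"
    let ?m = "nat \<lceil>2 * (M / (1 - discount D))\<^sup>2 / ?e\<^sup>2 * ln (2 / (\<delta> / real ?L / real (nS D * nA D)))\<rceil>"
    let ?B = "?L * (1 + round_time D n ?m) + 200"
    have "ennreal c \<le> ennreal (real n)" unfolding n_def by (intro ennreal_leI) linarith
    hence "is_sampler D (real n) smp" using smp unfolding is_sampler_def by (blast intro: order_trans)
    with A have ref: "refines (exec smp vi_prog (input_store D M \<epsilon> \<delta>)) (?run Min) (represents D) ?B"
      by (intro refines_vi_prog) auto
    show "map_pmf (\<lambda>(s, t). output_of D s) (exec smp vi_prog (input_store D M \<epsilon> \<delta>)) =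
       RandomizedVI Min D (\<lambda>_. 0) (nat \<lceil>1 / (1 - discount D) * ln (2 * M / ((1 - discount D)\<^sup>2 * \<epsilon>))\<rceil>)
           ((1 - discount D) * \<epsilon> / (4 * discount D)) \<delta>"
      by (rule refines_output[OF ref])
    show "expected_time (exec smp vi_prog (input_store D M \<epsilon> \<delta>)) \<le>
        ennreal (1542 * (real n + 541) * (real (nS D) * real (nA D) * M\<^sup>2 / ((1 - discount D) ^ 5 * \<epsilon>\<^sup>2)
                               * max 1 (ln (1 / \<epsilon>)))
                            * param_log D M \<epsilon> \<delta> ^ 2)"
      using ref time_bound[of D M \<epsilon> \<delta> n] A unfolding refines_def
      by (auto simp: ennreal_of_nat_eq_real_of_nat simp del: of_nat_add of_nat_mult
               intro: order_trans ennreal_leI)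
  next
    fix D :: dmdp and M \<epsilon> \<delta> :: real and tie :: "nat set \<Rightarrow> nat"
    assume "is_dmdp D M \<and> 0 < \<epsilon> \<and> \<epsilon> < M / (1 - discount D) \<and> 0 < \<delta> \<and> \<delta> < 1"
    thus "1 - \<delta> \<le> measure_pmf.prob
        (RandomizedVI tie D (\<lambda>_. 0) (nat \<lceil>1 / (1 - discount D) * ln (2 * M / ((1 - discount D)\<^sup>2 * \<epsilon>))\<rceil>)
           ((1 - discount D) * \<epsilon> / (4 * discount D)) \<delta>)
        {(v, \<pi>). sup_norm D (\<lambda>i. v i - opt_val D i) \<le> \<epsilon>}"
      by (intro RandomizedVI_correct) auto
  qed
qed

end
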